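(* Let $A$ be a unital associative ring and $B \subseteq A$ a subring with $1_B = 1_A$, and let $n \geq 1$. If the subring $B \subseteq A$ has H-depth $2n-1$, then it has depth $2n$. If $B \subseteq A$ has left depth $2n$ or right depth $2n$, then it has H-depth $2n+1$. As a consequence, if one of the minimum depth $d(B,A)$ and the minimum H-depth $d_H(B,A)$ is finite, then so is the other and $$|d(B,A) - d_H(B,A)| \leq 2.$$
   Context: $C_0(A,B) = B$ (as $B$-$B$-bimodule), and for $n \geq 1$, $C_n(A,B) = A \otimes_B \cdots \otimes_B A$ ($n$ factors $A$), an $A$-$A$-bimodule via multiplication on the outer factors, and by restriction an $A$-$B$-, $B$-$A$- and $B$-$B$-bimodule. For (bi)modules $M, N$, write $N \oplus * \cong M^q$ if $N$ is isomorphic to a direct summand of $M^q = M \oplus \cdots \oplus M$ ($q$ times); $M$ and $N$ are H-equivalent ($M \sim N$) if $N \oplus * \cong M^q$ and $M \oplus * \cong N^s$ for some positive integers $q,s$. The subring $B \subseteq A$ has H-depth $2n-1$ ($n \geq 1$) if $C_{n+1}(A,B) \oplus * \cong C_n(A,B)^q$ as $A$-$A$-bimodules for some positive integer $q$; $d_H(B,A)$ denotes the minimum H-depth ($\infty$ if there is none). The subring has right depth $2n$ ($n\ge 1$) if $C_{n+1}(A,B) \sim C_n(A,B)$ as $A$-$B$-bimodules; left depth $2n$ if the same holds as $B$-$A$-bimodules; depth $2n$ if both hold; depth $2n+1$ ($n \geq 0$) if $C_{n+1}(A,B) \sim C_n(A,B)$ as $B$-$B$-bimodules. The minimum depth $d(B,A)$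 is the least positive integer $m$ such that $B \subseteq A$ has depth $m$ ($\infty$ if there is none). *)

theory Defs
  imports
    "HOL-Algebra.Subrings"
    "HOL-Algebra.Generated_Groups"
    "HOL-Algebra.Free_Abelian_Groups"
    "HOL-Library.Extended_Nat"
begin

section \<open>Bimodules\<close>

text \<open>As for \<^locale>\<open>module\<close>, the additive group of a bimodule is stored in a ring record
  whose multiplicative part is irrelevant.  The acting rings \<open>R\<close>, \<open>S\<close> are not part of the
  record; restricting scalars to a subring \<open>B\<close> of \<open>R\<close> means replacing \<open>R\<close> by
  \<open>R\<lparr>carrier := B\<rparr>\<close> and keeping the record.\<close>

record ('a, 'b, 'm) bimodule = "'m ring" +
  lsmult :: "'a \<Rightarrow> 'm \<Rightarrow> 'm"
  rsmult :: "'m \<Rightarrow> 'b \<Rightarrow> 'm"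

locale bimodule = R?: ring R + S?: ring S + M?: abelian_group M
  for R :: "('a, 'r) ring_scheme" (structure) and S :: "('b, 's) ring_scheme" (structure)
    and M :: "('a, 'b, 'm, 'z) bimodule_scheme" (structure) +
  assumes lsmult_closed: "\<lbrakk>r \<in> carrier R; x \<in> carrier M\<rbrakk> \<Longrightarrow> lsmult M r x \<in> carrier M"
    and rsmult_closed: "\<lbrakk>x \<in> carrier M; s \<in> carrier S\<rbrakk> \<Longrightarrow> rsmult M x s \<in> carrier M"
    and lsmult_l_distr: "\<lbrakk>r \<in> carrier R; r' \<in> carrier R; x \<in> carrier M\<rbrakk> \<Longrightarrow>
      lsmult M (r \<oplus>\<^bsub>R\<^esub> r') x = lsmult M r x \<oplus>\<^bsub>M\<^esub> lsmult M r' x"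
    and lsmult_r_distr: "\<lbrakk>r \<in> carrier R; x \<in> carrier M; y \<in> carrier M\<rbrakk> \<Longrightarrow>
      lsmult M r (x \<oplus>\<^bsub>M\<^esub> y) = lsmult M r x \<oplus>\<^bsub>M\<^esub> lsmult M r y"
    and rsmult_l_distr: "\<lbrakk>x \<in> carrier M; y \<in> carrier M; s \<in> carrier S\<rbrakk> \<Longrightarrow>
      rsmult M (x \<oplus>\<^bsub>M\<^esub> y) s = rsmult M x s \<oplus>\<^bsub>M\<^esub> rsmult M y s"
    and rsmult_r_distr: "\<lbrakk>x \<in> carrier M; s \<in> carrier S; s' \<in> carrier S\<rbrakk> \<Longrightarrow>
      rsmult M x (s \<oplus>\<^bsub>S\<^esub> s') = rsmult M x s \<oplus>\<^bsub>M\<^esub> rsmult M x s'"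
    and lsmult_assoc: "\<lbrakk>r \<in> carrier R; r' \<in> carrier R; x \<in> carrier M\<rbrakk> \<Longrightarrow>
      lsmult M (r \<otimes>\<^bsub>R\<^esub> r') x = lsmult M r (lsmult M r' x)"
    and rsmult_assoc: "\<lbrakk>x \<in> carrier M; s \<in> carrier S; s' \<in> carrier S\<rbrakk> \<Longrightarrow>
      rsmult M x (s \<otimes>\<^bsub>S\<^esub> s') = rsmult M (rsmult M x s) s'"
    and lsmult_one: "x \<in> carrier M \<Longrightarrow> lsmult M \<one>\<^bsub>R\<^esub> x = x"
    and rsmult_one: "x \<in> carrier M \<Longrightarrow> rsmult M x \<one>\<^bsub>S\<^esub> = x"
    and smult_commute: "\<lbrakk>r \<in> carrier R; x \<in> carrier M; s \<in> carrier S\<rbrakk> \<Longrightarrow>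
      rsmult M (lsmult M r x) s = lsmult M r (rsmult M x s)"

definition bimodule_iso ::
  "('a, 'r) ring_scheme \<Rightarrow> ('b, 's) ring_scheme \<Rightarrow>
   ('a, 'b, 'm, 'y) bimodule_scheme \<Rightarrow> ('a, 'b, 'n, 'z) bimodule_scheme \<Rightarrow> bool" where
  "bimodule_iso R S M N \<longleftrightarrow>
    (\<exists>h \<in> iso (add_monoid M) (add_monoid N).
      (\<forall>r \<in> carrier R. \<forall>x \<in> carrier M. h (lsmult M r x) = lsmult N r (h x)) \<and>
      (\<forall>x \<in> carrier M. \<forall>s \<in> carrier S. h (rsmult M x s) = rsmult N (h x) s))"

definition subbimodule ::
  "'m set \<Rightarrow> ('a, 'r) ring_scheme \<Rightarrow> ('b, 's) ring_scheme \<Rightarrow>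
   ('a, 'b, 'm, 'z) bimodule_scheme \<Rightarrow> bool" where
  "subbimodule U R S M \<longleftrightarrow> subgroup U (add_monoid M) \<and>
    (\<forall>r \<in> carrier R. \<forall>x \<in> U. lsmult M r x \<in> U) \<and>
    (\<forall>x \<in> U. \<forall>s \<in> carrier S. rsmult M x s \<in> U)"

definition direct_summand ::
  "'m set \<Rightarrow> ('a, 'r) ring_scheme \<Rightarrow> ('b, 's) ring_scheme \<Rightarrow>
   ('a, 'b, 'm, 'z) bimodule_scheme \<Rightarrow> bool" where
  "direct_summand U R S M \<longleftrightarrow> subbimodule U R S M \<and>
    (\<exists>V. subbimodule V R S M \<and> U <+>\<^bsub>M\<^esub> V = carrier M \<and> U \<inter> V = {\<zero>\<^bsub>M\<^esub>})"

definition direct_power ::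
  "('a, 'b, 'm, 'z) bimodule_scheme \<Rightarrow> nat \<Rightarrow> ('a, 'b, nat \<Rightarrow> 'm) bimodule" where
  "direct_power M q =
    \<lparr>carrier = {..<q} \<rightarrow>\<^sub>E carrier M,
     monoid.mult = undefined,
     one = undefined,
     ring.zero = (\<lambda>i\<in>{..<q}. \<zero>\<^bsub>M\<^esub>),
     ring.add = (\<lambda>x y. \<lambda>i\<in>{..<q}. x i \<oplus>\<^bsub>M\<^esub> y i),
     lsmult = (\<lambda>r x. \<lambda>i\<in>{..<q}. lsmult M r (x i)),
     rsmult = (\<lambda>x s. \<lambda>i\<in>{..<q}. rsmult M (x i) s)\<rparr>"

text \<open>\<open>summand_of_power R S N M q\<close> is the relation \<open>N \<oplus> * \<cong> M\<^sup>q\<close> of \<open>R\<close>-\<open>S\<close>-bimodules.\<close>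

definition summand_of_power ::
  "('a, 'r) ring_scheme \<Rightarrow> ('b, 's) ring_scheme \<Rightarrow>
   ('a, 'b, 'n, 'y) bimodule_scheme \<Rightarrow> ('a, 'b, 'm, 'z) bimodule_scheme \<Rightarrow> nat \<Rightarrow> bool" where
  "summand_of_power R S N M q \<longleftrightarrow>
    (\<exists>U. direct_summand U R S (direct_power M q) \<and>
         bimodule_iso R S N ((direct_power M q)\<lparr>carrier := U\<rparr>))"

definition H_equivalent ::
  "('a, 'r) ring_scheme \<Rightarrow> ('b, 's) ring_scheme \<Rightarrow>
   ('a, 'b, 'm, 'y) bimodule_scheme \<Rightarrow> ('a, 'b, 'n, 'z) bimodule_scheme \<Rightarrow> bool" where
  "H_equivalent R S M N \<longleftrightarrow>
    (\<exists>q \<ge> 1. summand_of_power R S N M q) \<and> (\<exists>s \<ge> 1. summand_of_power R S M N s)"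

definition regular_bimodule :: "('a, 'r) ring_scheme \<Rightarrow> ('a, 'a, 'a) bimodule" where
  "regular_bimodule R =
    \<lparr>carrier = carrier R, monoid.mult = monoid.mult R, one = one R,
     ring.zero = ring.zero R, ring.add = ring.add R,
     lsmult = monoid.mult R, rsmult = monoid.mult R\<rparr>"


section \<open>The bimodules \<open>A \<otimes>\<^sub>B \<cdots> \<otimes>\<^sub>B A\<close>\<close>

text \<open>The \<open>n\<close>-fold tensor product is the free abelian group on \<open>n\<close>-tuples of elements of \<open>A\<close>,
  written as lists, modulo additivity in every slot and \<open>B\<close>-balancedness between neighbouring
  slots.  It is formed in one step rather than by iterating a binary tensor product because
  the type of the result must not depend on \<open>n\<close>.\<close>

definition tuples :: "('a, 'r) ring_scheme \<Rightarrow> nat \<Rightarrow> 'a list set" where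
  "tuples A n = {xs. length xs = n \<and> set xs \<subseteq> carrier A}"

definition tensor_relators ::
  "('a, 'r) ring_scheme \<Rightarrow> 'a set \<Rightarrow> nat \<Rightarrow> ('a list \<Rightarrow>\<^sub>0 int) set" where
  "tensor_relators A B n =
    {frag_of (xs @ (x \<oplus>\<^bsub>A\<^esub> y) # ys) - frag_of (xs @ x # ys) - frag_of (xs @ y # ys) |xs x y ys.
       xs @ x # ys \<in> tuples A n \<and> y \<in> carrier A} \<union>
    {frag_of (xs @ (x \<otimes>\<^bsub>A\<^esub> b) # y # ys) - frag_of (xs @ x # (b \<otimes>\<^bsub>A\<^esub> y) # ys) |xs x b y ys.
       xs @ x # y # ys \<in> tuples A n \<and> b \<in> B}"

definition tensor_kernel ::
  "('a, 'r) ring_scheme \<Rightarrow> 'a set \<Rightarrow> nat \<Rightarrow> ('a list \<Rightarrow>\<^sub>0 int) set" where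
  "tensor_kernel A B n = generate (free_Abelian_group (tuples A n)) (tensor_relators A B n)"

definition tensor_group ::
  "('a, 'r) ring_scheme \<Rightarrow> 'a set \<Rightarrow> nat \<Rightarrow> ('a list \<Rightarrow>\<^sub>0 int) set monoid" where
  "tensor_group A B n = free_Abelian_group (tuples A n) Mod tensor_kernel A B n"

text \<open>The additive map on the quotient induced by a map \<open>g\<close> of tuples that respects the
  relators: the coset of \<open>c\<close> goes to the coset of the image of \<open>c\<close>.\<close>

definition tensor_induced ::
  "('a, 'r) ring_scheme \<Rightarrow> 'a set \<Rightarrow> nat \<Rightarrow> ('a list \<Rightarrow> 'a list) \<Rightarrow>
   ('a list \<Rightarrow>\<^sub>0 int) set \<Rightarrow> ('a list \<Rightarrow>\<^sub>0 int) set" where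
  "tensor_induced A B n g X =
    tensor_kernel A B n <#>\<^bsub>free_Abelian_group (tuples A n)\<^esub> frag_extend (frag_of \<circ> g) ` X"

text \<open>\<open>tensor_power A B n\<close> is \<open>C\<^sub>n(A, B)\<close> for \<open>n \<ge> 1\<close>, with
  \<open>a (x\<^sub>1 \<otimes> \<cdots> \<otimes> x\<^sub>n) a' = a x\<^sub>1 \<otimes> \<cdots> \<otimes> x\<^sub>n a'\<close>.  The case \<open>C\<^sub>0(A, B) = B\<close>, which lives on another
  type and is only a \<open>B\<close>-\<open>B\<close>-bimodule, is \<open>regular_bimodule (A\<lparr>carrier := B\<rparr>)\<close>.\<close>

definition tensor_power ::
  "('a, 'r) ring_scheme \<Rightarrow> 'a set \<Rightarrow> nat \<Rightarrow> ('a, 'a, ('a list \<Rightarrow>\<^sub>0 int) set) bimodule" where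
  "tensor_power A B n =
    \<lparr>carrier = carrier (tensor_group A B n),
     monoid.mult = undefined,
     one = undefined,
     ring.zero = \<one>\<^bsub>tensor_group A B n\<^esub>,
     ring.add = monoid.mult (tensor_group A B n),
     lsmult = (\<lambda>a. tensor_induced A B n (\<lambda>xs. (a \<otimes>\<^bsub>A\<^esub> hd xs) # tl xs)),
     rsmult = (\<lambda>X a. tensor_induced A B n (\<lambda>xs. butlast xs @ [last xs \<otimes>\<^bsub>A\<^esub> a]) X)\<rparr>"


section \<open>Depth and H-depth\<close>

definition has_H_depth :: "('a, 'r) ring_scheme \<Rightarrow> 'a set \<Rightarrow> nat \<Rightarrow> bool" where
  "has_H_depth A B m \<longleftrightarrow> (\<exists>n \<ge> 1. m = 2 * n - 1 \<and>
    (\<exists>q \<ge> 1. summand_of_power A A (tensor_power A B (n + 1)) (tensor_power A B n) q))"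

definition has_right_depth :: "('a, 'r) ring_scheme \<Rightarrow> 'a set \<Rightarrow> nat \<Rightarrow> bool" where
  "has_right_depth A B m \<longleftrightarrow> (\<exists>n \<ge> 1. m = 2 * n \<and>
    H_equivalent A (A\<lparr>carrier := B\<rparr>) (tensor_power A B (n + 1)) (tensor_power A B n))"

definition has_left_depth :: "('a, 'r) ring_scheme \<Rightarrow> 'a set \<Rightarrow> nat \<Rightarrow> bool" where
  "has_left_depth A B m \<longleftrightarrow> (\<exists>n \<ge> 1. m = 2 * n \<and>
    H_equivalent (A\<lparr>carrier := B\<rparr>) A (tensor_power A B (n + 1)) (tensor_power A B n))"

definition has_odd_depth :: "('a, 'r) ring_scheme \<Rightarrow> 'a set \<Rightarrow> nat \<Rightarrow> bool" where
  "has_odd_depth A B m \<longleftrightarrow> (\<exists>n. m = 2 * n + 1 \<and>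
    (if n = 0
     then H_equivalent (A\<lparr>carrier := B\<rparr>) (A\<lparr>carrier := B\<rparr>)
            (tensor_power A B 1) (regular_bimodule (A\<lparr>carrier := B\<rparr>))
     else H_equivalent (A\<lparr>carrier := B\<rparr>) (A\<lparr>carrier := B\<rparr>)
            (tensor_power A B (n + 1)) (tensor_power A B n)))"

definition has_depth :: "('a, 'r) ring_scheme \<Rightarrow> 'a set \<Rightarrow> nat \<Rightarrow> bool" where
  "has_depth A B m \<longleftrightarrow>
    (has_left_depth A B m \<and> has_right_depth A B m) \<or> has_odd_depth A B m"

text \<open>The infimum of the empty set in \<^typ>\<open>enat\<close> is \<open>\<infinity>\<close>.\<close>

definition min_depth :: "('a, 'r) ring_scheme \<Rightarrow> 'a set \<Rightarrow> enat" where
  "min_depth A B = Inf {enat m |m. 0 < m \<and> has_depth A B m}"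

definition min_H_depth :: "('a, 'r) ring_scheme \<Rightarrow> 'a set \<Rightarrow> enat" where
  "min_H_depth A B = Inf {enat m |m. has_H_depth A B m}"

end

theory Submission
  imports Defs
begin

text \<open>
  Write \<open>C\<^sub>n\<close> for \<open>C\<^sub>n(A, B)\<close> and \<open>N | M\<^sup>q\<close> for \<open>N \<oplus> * \<cong> M\<^sup>q\<close>. The proof rests on two facts about the functor
  \<open>A \<otimes>\<^sub>B -\<close>, which takes \<open>C\<^sub>n\<close> to \<open>C\<^sub>n\<^sub>+\<^sub>1\<close> (and \<open>C\<^sub>0 = B\<close> to \<open>C\<^sub>1 = A\<close>), and their mirror images for
  \<open>- \<otimes>\<^sub>B A\<close>.

  It is additive, so it preserves \<open>N | M\<^sup>q\<close>, and its values are linear over \<open>A\<close> on the left even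
  where the given modules were linear over \<open>B\<close> only (\<open>induced_summand_of_power\<close>). Thus
  \<open>C\<^sub>n\<^sub>+\<^sub>1 | C\<^sub>n\<^sup>q\<close> over \<open>B\<close>-\<open>A\<close>, which is part of left depth \<open>2n\<close>, gives \<open>C\<^sub>n\<^sub>+\<^sub>2 | C\<^sub>n\<^sub>+\<^sub>1\<^sup>q\<close> over \<open>A\<close>-\<open>A\<close>, which is
  H-depth \<open>2n + 1\<close>. If the relation holds over \<open>B\<close>-\<open>B\<close> only, which is part of depth \<open>2n + 1\<close>, applying
  the functors of both sides yields H-depth \<open>2n + 3\<close>.

  Conversely, \<open>C\<^sub>n\<close> is always a summand of \<open>C\<^sub>n\<^sub>+\<^sub>1\<close> over \<open>B\<close>-\<open>A\<close>, because multiplication of the first two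
  factors is split by \<open>c \<mapsto> 1 \<otimes> c\<close> (\<open>induced_counit_splits\<close>). An H-depth condition, restricted to \<open>B\<close> on
  one side, therefore is already an H-equivalence, and H-depth \<open>2n - 1\<close> implies left and right depth
  \<open>2n\<close>. Altogether \<open>d(B, A) \<le> d\<^sub>H(B, A) + 1\<close> and \<open>d\<^sub>H(B, A) \<le> d(B, A) + 2\<close>.

  Three devices keep the bookkeeping small. The relation \<open>N | M\<^sup>q\<close> is rephrased as a factorisation of
  the identity of \<open>N\<close> as a sum of \<open>q\<close> endomorphisms through \<open>M\<close> (\<open>summand_of_power_iff\<close>); homomorphisms out of \<open>C\<^sub>n\<close> are
  built and compared on pure tensors by the universal property (\<open>tensor_group_universal\<close>); and the
  right-handed statements are the left-handed ones for the opposite ring, to which tensors are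
  carried by reversal (\<open>summand_opposite\<close>).
\<close>

section \<open>Bimodule homomorphisms and summands of powers\<close>

definition bimodule_hom ::
  "('a, 'r) ring_scheme \<Rightarrow> ('b, 's) ring_scheme \<Rightarrow>
   ('a, 'b, 'm, 'y) bimodule_scheme \<Rightarrow> ('a, 'b, 'n, 'z) bimodule_scheme \<Rightarrow> ('m \<Rightarrow> 'n) set" where
  "bimodule_hom R S M N = {h \<in> hom (add_monoid M) (add_monoid N).
      (\<forall>r \<in> carrier R. \<forall>x \<in> carrier M. h (lsmult M r x) = lsmult N r (h x)) \<and>
      (\<forall>x \<in> carrier M. \<forall>s \<in> carrier S. h (rsmult M x s) = rsmult N (h x) s)}"

lemma bimodule_homI:
  assumes "\<And>x. x \<in> carrier M \<Longrightarrow> h x \<in> carrier N"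
    and "\<And>x y. \<lbrakk>x \<in> carrier M; y \<in> carrier M\<rbrakk> \<Longrightarrow> h (x \<oplus>\<^bsub>M\<^esub> y) = h x \<oplus>\<^bsub>N\<^esub> h y"
    and "\<And>r x. \<lbrakk>r \<in> carrier R; x \<in> carrier M\<rbrakk> \<Longrightarrow> h (lsmult M r x) = lsmult N r (h x)"
    and "\<And>x s. \<lbrakk>x \<in> carrier M; s \<in> carrier S\<rbrakk> \<Longrightarrow> h (rsmult M x s) = rsmult N (h x) s"
  shows "h \<in> bimodule_hom R S M N"
  using assms by (auto simp: bimodule_hom_def hom_def)

lemma bimodule_homD:
  assumes "h \<in> bimodule_hom R S M N"
  shows "h \<in> hom (add_monoid M) (add_monoid N)"
    and "x \<in> carrier M \<Longrightarrow> h x \<in> carrier N"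
    and "\<lbrakk>x \<in> carrier M; y \<in> carrier M\<rbrakk> \<Longrightarrow> h (x \<oplus>\<^bsub>M\<^esub> y) = h x \<oplus>\<^bsub>N\<^esub> h y"
    and "\<lbrakk>r \<in> carrier R; x \<in> carrier M\<rbrakk> \<Longrightarrow> h (lsmult M r x) = lsmult N r (h x)"
    and "\<lbrakk>x \<in> carrier M; s \<in> carrier S\<rbrakk> \<Longrightarrow> h (rsmult M x s) = rsmult N (h x) s"
  using assms by (auto simp: bimodule_hom_def hom_def)

lemma bimodule_hom_compose:
  assumes "g \<in> bimodule_hom R S M N" and "h \<in> bimodule_hom R S N P"
  shows "(\<lambda>x. h (g x)) \<in> bimodule_hom R S M P"
  by (rule bimodule_homI) (simp_all add: bimodule_homD[OF assms(1)] bimodule_homD[OF assms(2)])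

lemma (in bimodule) lsmult_zero: "r \<in> carrier R \<Longrightarrow> lsmult M r \<zero>\<^bsub>M\<^esub> = \<zero>\<^bsub>M\<^esub>"
  using lsmult_r_distr[of r "\<zero>\<^bsub>M\<^esub>" "\<zero>\<^bsub>M\<^esub>"] lsmult_closed[of r "\<zero>\<^bsub>M\<^esub>"]
  by (metis M.add.r_cancel_one' M.l_zero M.zero_closed)

lemma (in bimodule) rsmult_zero: "s \<in> carrier S \<Longrightarrow> rsmult M \<zero>\<^bsub>M\<^esub> s = \<zero>\<^bsub>M\<^esub>"
  using rsmult_l_distr[of "\<zero>\<^bsub>M\<^esub>" "\<zero>\<^bsub>M\<^esub>" s] rsmult_closed[of "\<zero>\<^bsub>M\<^esub>" s]
  by (metis M.add.r_cancel_one' M.l_zero M.zero_closed)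

lemma bimodule_abelian_group: "bimodule R S M \<Longrightarrow> abelian_group M"
  by (rule bimodule.axioms)

lemma add_hom_zero:
  assumes "abelian_group M" "abelian_group N" "h \<in> hom (add_monoid M) (add_monoid N)"
  shows "h \<zero>\<^bsub>M\<^esub> = \<zero>\<^bsub>N\<^esub>"
  using hom_one[OF assms(3)] assms(1,2) by (simp add: abelian_group.a_group)

lemma add_hom_finsum:
  assumes M: "abelian_group M" and N: "abelian_group N"
    and h: "h \<in> hom (add_monoid M) (add_monoid N)"
    and "finite I" "f \<in> I \<rightarrow> carrier M"
  shows "h (\<Oplus>\<^bsub>M\<^esub>i\<in>I. f i) = (\<Oplus>\<^bsub>N\<^esub>i\<in>I. h (f i))"
  using \<open>finite I\<close> \<open>f \<in> I \<rightarrow> carrier M\<close>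
proof (induction I rule: finite_induct)
  case empty
  then show ?case
    using add_hom_zero[OF M N h] M N by (simp add: abelian_group.axioms(1) abelian_monoid.finsum_empty)
next
  case (insert j I)
  interpret M: abelian_group M by (rule M)
  interpret N: abelian_group N by (rule N)
  have hc: "\<And>x. x \<in> carrier M \<Longrightarrow> h x \<in> carrier N"
    and ha: "\<And>x y. \<lbrakk>x \<in> carrier M; y \<in> carrier M\<rbrakk> \<Longrightarrow> h (x \<oplus>\<^bsub>M\<^esub> y) = h x \<oplus>\<^bsub>N\<^esub> h y"
    using h by (auto simp: hom_def)
  have f: "f \<in> I \<rightarrow> carrier M" "f j \<in> carrier M" using insert.prems by auto
  have hf: "(\<lambda>i. h (f i)) \<in> I \<rightarrow> carrier N" "h (f j) \<in> carrier N" using f hc by auto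
  show ?case
    using insert.hyps f hf insert.IH[OF f(1)] ha by (simp add: M.finsum_insert N.finsum_insert)
qed

text \<open>The kernel of a retraction is a complement of the image of the section; conversely, the projection
  along a complement, followed by the inverse of the isomorphism, is a retraction.\<close>

lemma direct_summand_iff_retract:
  assumes P: "bimodule R S P" and N: "bimodule R S N"
  shows "(\<exists>U. direct_summand U R S P \<and> bimodule_iso R S N (P\<lparr>carrier := U\<rparr>)) \<longleftrightarrow>
    (\<exists>h \<in> bimodule_hom R S N P. \<exists>p \<in> bimodule_hom R S P N. \<forall>x \<in> carrier N. p (h x) = x)"
    (is "?summand \<longleftrightarrow> ?retract")
proof
  interpret P: bimodule R S P by (rule P)
  interpret N: bimodule R S N by (rule N)
  {
    assume ?summand
    then obtain U V h where U: "subbimodule U R S P" and V: "subbimodule V R S P"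
      and UV: "U <+>\<^bsub>P\<^esub> V = carrier P" "U \<inter> V = {\<zero>\<^bsub>P\<^esub>}"
      and h: "h \<in> iso (add_monoid N) (add_monoid (P\<lparr>carrier := U\<rparr>))"
      and hl: "\<And>r x. \<lbrakk>r \<in> carrier R; x \<in> carrier N\<rbrakk> \<Longrightarrow> h (lsmult N r x) = lsmult P r (h x)"
      and hr: "\<And>x s. \<lbrakk>x \<in> carrier N; s \<in> carrier S\<rbrakk> \<Longrightarrow> h (rsmult N x s) = rsmult P (h x) s"
      by (auto simp: direct_summand_def bimodule_iso_def)
    have subU: "subgroup U (add_monoid P)" and subV: "subgroup V (add_monoid P)"
      using U V by (auto simp: subbimodule_def)
    have UP: "u \<in> carrier P" if "u \<in> U" for u using subgroup.mem_carrier[OF subU] that by simp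
    have VP: "v \<in> carrier P" if "v \<in> V" for v using subgroup.mem_carrier[OF subV] that by simp
    have Ua: "u \<oplus>\<^bsub>P\<^esub> u' \<in> U" if "u \<in> U" "u' \<in> U" for u u'
      using subgroup.m_closed[OF subU] that by simp
    have Va: "v \<oplus>\<^bsub>P\<^esub> v' \<in> V" if "v \<in> V" "v' \<in> V" for v v'
      using subgroup.m_closed[OF subV] that by simp
    have Um: "\<ominus>\<^bsub>P\<^esub> u \<in> U" if "u \<in> U" for u
      using subgroup.m_inv_closed[OF subU that] by (simp add: a_inv_def)
    have Vm: "\<ominus>\<^bsub>P\<^esub> v \<in> V" if "v \<in> V" for v
      using subgroup.m_inv_closed[OF subV that] by (simp add: a_inv_def)
    have hU: "h x \<in> U" if "x \<in> carrier N" for x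
      using h that by (auto simp: iso_def hom_def)
    have hadd: "h (x \<oplus>\<^bsub>N\<^esub> y) = h x \<oplus>\<^bsub>P\<^esub> h y" if "x \<in> carrier N" "y \<in> carrier N" for x y
      using h that by (auto simp: iso_def hom_def)
    have bij: "bij_betw h (carrier N) U" using h by (auto simp: iso_def)
    have hom_h: "h \<in> bimodule_hom R S N P"
      by (rule bimodule_homI) (auto simp: hU UP hadd hl hr)
    \<comment> \<open>The projection onto \<open>U\<close> along \<open>V\<close>, followed by the inverse of \<open>h\<close>.\<close>
    define p where "p w = (THE x. x \<in> carrier N \<and> (\<exists>v\<in>V. w = h x \<oplus>\<^bsub>P\<^esub> v))" for w
    have ex: "\<exists>x \<in> carrier N. \<exists>v\<in>V. w = h x \<oplus>\<^bsub>P\<^esub> v" if "w \<in> carrier P" for w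
    proof -
      have "w \<in> U <+>\<^bsub>P\<^esub> V" using that UV(1) by simp
      then obtain u v where "u \<in> U" "v \<in> V" "w = u \<oplus>\<^bsub>P\<^esub> v"
        by (auto simp: set_add_def' set_mult_def)
      moreover obtain x where "x \<in> carrier N" "u = h x"
        using bij \<open>u \<in> U\<close> by (auto simp: bij_betw_def)
      ultimately show ?thesis by blast
    qed
    have uniq: "x = x'" if "x \<in> carrier N" "x' \<in> carrier N" "v \<in> V" "v' \<in> V"
      "h x \<oplus>\<^bsub>P\<^esub> v = h x' \<oplus>\<^bsub>P\<^esub> v'" for x x' v v'
    proof -
      have c: "h x \<in> carrier P" "h x' \<in> carrier P" "v \<in> carrier P" "v' \<in> carrier P"
        using that hU UP VP by auto
      have "\<ominus>\<^bsub>P\<^esub> h x' \<oplus>\<^bsub>P\<^esub> h x = v' \<oplus>\<^bsub>P\<^esub> \<ominus>\<^bsub>P\<^esub> v"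
      proof -
        have "\<ominus>\<^bsub>P\<^esub> h x' \<oplus>\<^bsub>P\<^esub> h x = \<ominus>\<^bsub>P\<^esub> h x' \<oplus>\<^bsub>P\<^esub> ((h x \<oplus>\<^bsub>P\<^esub> v) \<oplus>\<^bsub>P\<^esub> \<ominus>\<^bsub>P\<^esub> v)"
          using c by (simp add: P.a_assoc P.r_neg)
        also have "\<dots> = v' \<oplus>\<^bsub>P\<^esub> \<ominus>\<^bsub>P\<^esub> v"
          using c unfolding that(5) by (simp add: P.a_assoc P.r_neg P.r_neg1)
        finally show ?thesis .
      qed
      moreover have "\<ominus>\<^bsub>P\<^esub> h x' \<oplus>\<^bsub>P\<^esub> h x \<in> U" using that hU Ua Um by auto
      moreover have "v' \<oplus>\<^bsub>P\<^esub> \<ominus>\<^bsub>P\<^esub> v \<in> V" using that Va Vm by auto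
      ultimately have "\<ominus>\<^bsub>P\<^esub> h x' \<oplus>\<^bsub>P\<^esub> h x = \<zero>\<^bsub>P\<^esub>" using UV(2) by auto
      then have "h x = h x'"
        using c by (metis P.a_comm P.a_inv_closed P.minus_equality P.minus_minus)
      then show ?thesis using bij that(1,2) by (auto simp: bij_betw_def inj_on_def)
    qed
    have p_eq: "p (h x \<oplus>\<^bsub>P\<^esub> v) = x" if "x \<in> carrier N" "v \<in> V" for x v
      unfolding p_def
    proof (rule the_equality)
      show "x \<in> carrier N \<and> (\<exists>v'\<in>V. h x \<oplus>\<^bsub>P\<^esub> v = h x \<oplus>\<^bsub>P\<^esub> v')" using that by blast
      show "x' = x" if "x' \<in> carrier N \<and> (\<exists>v'\<in>V. h x \<oplus>\<^bsub>P\<^esub> v = h x' \<oplus>\<^bsub>P\<^esub> v')" for x'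
        using that uniq[OF \<open>x \<in> carrier N\<close> _ \<open>v \<in> V\<close>] by metis
    qed
    have "p \<in> bimodule_hom R S P N"
    proof (rule bimodule_homI)
      show "p w \<in> carrier N" if "w \<in> carrier P" for w
        using ex[OF that] p_eq by auto
    next
      fix w w' assume "w \<in> carrier P" "w' \<in> carrier P"
      then obtain x v x' v' where x: "x \<in> carrier N" "v \<in> V" "w = h x \<oplus>\<^bsub>P\<^esub> v"
        and x': "x' \<in> carrier N" "v' \<in> V" "w' = h x' \<oplus>\<^bsub>P\<^esub> v'" using ex by meson
      have "w \<oplus>\<^bsub>P\<^esub> w' = h (x \<oplus>\<^bsub>N\<^esub> x') \<oplus>\<^bsub>P\<^esub> (v \<oplus>\<^bsub>P\<^esub> v')"
        using x x' hU UP VP by (simp add: hadd P.a_ac)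
      then show "p (w \<oplus>\<^bsub>P\<^esub> w') = p w \<oplus>\<^bsub>N\<^esub> p w'"
        using x x' Va p_eq by simp
    next
      fix r w assume r: "r \<in> carrier R" and "w \<in> carrier P"
      then obtain x v where x: "x \<in> carrier N" "v \<in> V" "w = h x \<oplus>\<^bsub>P\<^esub> v" using ex by meson
      have "lsmult P r w = h (lsmult N r x) \<oplus>\<^bsub>P\<^esub> lsmult P r v"
        using x r hU UP VP by (simp add: hl P.lsmult_r_distr)
      moreover have "lsmult P r v \<in> V" using V r x by (auto simp: subbimodule_def)
      ultimately show "p (lsmult P r w) = lsmult N r (p w)"
        using x r p_eq by (simp add: N.lsmult_closed)
    next
      fix s w assume s: "s \<in> carrier S" and "w \<in> carrier P"
      then obtain x v where x: "x \<in> carrier N" "v \<in> V" "w = h x \<oplus>\<^bsub>P\<^esub> v" using ex by meson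
      have "rsmult P w s = h (rsmult N x s) \<oplus>\<^bsub>P\<^esub> rsmult P v s"
        using x s hU UP VP by (simp add: hr P.rsmult_l_distr)
      moreover have "rsmult P v s \<in> V" using V s x by (auto simp: subbimodule_def)
      ultimately show "p (rsmult P w s) = rsmult N (p w) s"
        using x s p_eq by (simp add: N.rsmult_closed)
    qed
    moreover have "p (h x) = x" if "x \<in> carrier N" for x
    proof -
      have "\<zero>\<^bsub>P\<^esub> \<in> V" using UV(2) by auto
      then show ?thesis using p_eq[of x "\<zero>\<^bsub>P\<^esub>"] that hU UP by simp
    qed
    ultimately show ?retract using hom_h by blast
  }
  {
    assume ?retract
    then obtain h p where h: "h \<in> bimodule_hom R S N P" and p: "p \<in> bimodule_hom R S P N"
      and ph: "\<And>x. x \<in> carrier N \<Longrightarrow> p (h x) = x" by blast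
    note hD = bimodule_homD[OF h] and pD = bimodule_homD[OF p]
    have p0: "p \<zero>\<^bsub>P\<^esub> = \<zero>\<^bsub>N\<^esub>"
      by (rule add_hom_zero[OF bimodule_abelian_group[OF P] bimodule_abelian_group[OF N] pD(1)])
    have h0: "h \<zero>\<^bsub>N\<^esub> = \<zero>\<^bsub>P\<^esub>"
      by (rule add_hom_zero[OF bimodule_abelian_group[OF N] bimodule_abelian_group[OF P] hD(1)])
    define U where "U = h ` carrier N"
    define V where "V = {w \<in> carrier P. p w = \<zero>\<^bsub>N\<^esub>}"
    have gh: "group_hom (add_monoid N) (add_monoid P) h"
      using hD(1) N.a_group P.a_group by (simp add: group_hom_def group_hom_axioms_def)
    have gp: "group_hom (add_monoid P) (add_monoid N) p"
      using pD(1) N.a_group P.a_group by (simp add: group_hom_def group_hom_axioms_def)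
    have "subbimodule U R S P"
      unfolding subbimodule_def
    proof (intro conjI ballI)
      show "subgroup U (add_monoid P)"
        using group_hom.img_is_subgroup[OF gh] by (simp add: U_def)
    qed (auto simp: U_def hD(4,5)[symmetric] N.lsmult_closed N.rsmult_closed)
    moreover have "subbimodule V R S P"
      unfolding subbimodule_def
    proof (intro conjI ballI)
      show "subgroup V (add_monoid P)"
        using group_hom.subgroup_kernel[OF gp] by (simp add: V_def kernel_def)
    qed (auto simp: V_def pD N.lsmult_zero N.rsmult_zero P.lsmult_closed P.rsmult_closed)
    moreover have "U <+>\<^bsub>P\<^esub> V = carrier P"
    proof
      show "U <+>\<^bsub>P\<^esub> V \<subseteq> carrier P"
        by (auto simp: U_def V_def set_add_def' set_mult_def hD)
      show "carrier P \<subseteq> U <+>\<^bsub>P\<^esub> V"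
      proof
        fix w assume w: "w \<in> carrier P"
        have c: "h (p w) \<in> carrier P" using w pD hD by auto
        have "p (w \<oplus>\<^bsub>P\<^esub> \<ominus>\<^bsub>P\<^esub> h (p w)) = p w \<oplus>\<^bsub>N\<^esub> p (\<ominus>\<^bsub>P\<^esub> h (p w))"
          using w c pD(3) by simp
        also have "p (\<ominus>\<^bsub>P\<^esub> h (p w)) = \<ominus>\<^bsub>N\<^esub> p w"
          using group_hom.hom_inv[OF gp, of "h (p w)"] c ph[OF pD(2)[OF w]] by (simp add: a_inv_def)
        finally have "w \<oplus>\<^bsub>P\<^esub> \<ominus>\<^bsub>P\<^esub> h (p w) \<in> V"
          using w c pD(2)[OF w] by (simp add: V_def N.r_neg)
        moreover have "h (p w) \<in> U" using w pD by (auto simp: U_def)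
        moreover have "w = h (p w) \<oplus>\<^bsub>P\<^esub> (w \<oplus>\<^bsub>P\<^esub> \<ominus>\<^bsub>P\<^esub> h (p w))"
          using w c by (metis P.a_inv_closed P.a_lcomm P.r_neg P.r_zero)
        ultimately show "w \<in> U <+>\<^bsub>P\<^esub> V" by (auto simp: set_add_def' set_mult_def)
      qed
    qed
    moreover have "U \<inter> V = {\<zero>\<^bsub>P\<^esub>}"
    proof
      show "U \<inter> V \<subseteq> {\<zero>\<^bsub>P\<^esub>}" using ph h0 by (auto simp: U_def V_def)
      show "{\<zero>\<^bsub>P\<^esub>} \<subseteq> U \<inter> V"
        using h0 p0 image_eqI[of "\<zero>\<^bsub>P\<^esub>" h "\<zero>\<^bsub>N\<^esub>"] by (auto simp: U_def V_def)
    qed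
    ultimately have "direct_summand U R S P" unfolding direct_summand_def by blast
    moreover have "bimodule_iso R S N (P\<lparr>carrier := U\<rparr>)"
      unfolding bimodule_iso_def
    proof (rule bexI[where x = h])
      have "inj_on h (carrier N)" using ph by (metis inj_onI)
      then show "h \<in> iso (add_monoid N) (add_monoid (P\<lparr>carrier := U\<rparr>))"
        by (auto simp: iso_def hom_def U_def hD bij_betw_def)
    qed (simp add: hD)
    ultimately show ?summand by blast
  }
qed

lemma direct_power_sel [simp]:
  "carrier (direct_power M q) = {..<q} \<rightarrow>\<^sub>E carrier M"
  "\<zero>\<^bsub>direct_power M q\<^esub> = (\<lambda>i\<in>{..<q}. \<zero>\<^bsub>M\<^esub>)"
  "x \<oplus>\<^bsub>direct_power M q\<^esub> y = (\<lambda>i\<in>{..<q}. x i \<oplus>\<^bsub>M\<^esub> y i)"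
  "lsmult (direct_power M q) r x = (\<lambda>i\<in>{..<q}. lsmult M r (x i))"
  "rsmult (direct_power M q) x s = (\<lambda>i\<in>{..<q}. rsmult M (x i) s)"
  by (simp_all add: direct_power_def)

lemma direct_power_bimodule:
  assumes "bimodule R S M"
  shows "bimodule R S (direct_power M q)"
proof -
  interpret M: bimodule R S M by (rule assms)
  have c: "x i \<in> carrier M" if "x \<in> {..<q} \<rightarrow>\<^sub>E carrier M" "i < q" for x i
    using that by auto
  have ext: "(\<lambda>i\<in>{..<q}. x i) = x" if "x \<in> {..<q} \<rightarrow>\<^sub>E carrier M" for x
    using that by (rule PiE_restrict)
  have "abelian_group (direct_power M q)"
  proof (rule abelian_groupI)
    fix x assume x: "x \<in> carrier (direct_power M q)"
    then have "(\<lambda>i\<in>{..<q}. \<ominus>\<^bsub>M\<^esub> x i) \<oplus>\<^bsub>direct_power M q\<^esub> x = \<zero>\<^bsub>direct_power M q\<^esub>"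
      by (simp add: c M.l_neg cong: restrict_cong)
    then show "\<exists>y\<in>carrier (direct_power M q). y \<oplus>\<^bsub>direct_power M q\<^esub> x = \<zero>\<^bsub>direct_power M q\<^esub>"
      using x by (intro bexI[where x = "\<lambda>i\<in>{..<q}. \<ominus>\<^bsub>M\<^esub> x i"]) (auto intro: c)
  qed (simp_all add: c ext M.a_ac cong: restrict_cong)
  then show ?thesis
    by (intro bimodule.intro bimodule_axioms.intro M.R.ring_axioms M.S.ring_axioms)
      (simp_all add: c ext M.lsmult_closed M.rsmult_closed M.lsmult_l_distr M.lsmult_r_distr
        M.rsmult_l_distr M.rsmult_r_distr M.lsmult_assoc M.rsmult_assoc M.lsmult_one M.rsmult_one
        M.smult_commute cong: restrict_cong)
qed

text \<open>A homomorphism into \<open>M\<^sup>q\<close> is a \<open>q\<close>-tuple of homomorphisms into \<open>M\<close>, a homomorphism out of it is a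
  sum of homomorphisms out of \<open>M\<close>, so a retraction of \<open>M\<^sup>q\<close> onto \<open>N\<close> is a factorisation of the identity
  of \<open>N\<close> as a sum of \<open>q\<close> endomorphisms through \<open>M\<close>. This form of \<open>N \<oplus> * \<cong> M\<^sup>q\<close> mentions only
  homomorphisms and sums, which is why every additive functor, restriction of scalars and
  \<open>A \<otimes>\<^sub>B -\<close> in particular, visibly preserves it.\<close>

lemma summand_of_power_iff:
  assumes M: "bimodule R S M" and N: "bimodule R S N"
  shows "summand_of_power R S N M q \<longleftrightarrow>
    (\<exists>f g. (\<forall>i<q. f i \<in> bimodule_hom R S M N \<and> g i \<in> bimodule_hom R S N M) \<and>
      (\<forall>x \<in> carrier N. (\<Oplus>\<^bsub>N\<^esub>i\<in>{..<q}. f i (g i x)) = x))" (is "_ \<longleftrightarrow> ?split")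
proof -
  interpret M: bimodule R S M by (rule M)
  interpret N: bimodule R S N by (rule N)
  let ?P = "direct_power M q"
  have P: "bimodule R S ?P" by (rule direct_power_bimodule[OF M])
  interpret P: bimodule R S ?P by (rule P)
  have sum_coord: "(\<Oplus>\<^bsub>?P\<^esub>i\<in>I. v i) j = (\<Oplus>\<^bsub>M\<^esub>i\<in>I. v i j)"
    if "j < q" "finite I" "\<And>i. i \<in> I \<Longrightarrow> v i \<in> carrier ?P" for I j and v :: "nat \<Rightarrow> nat \<Rightarrow> _"
  proof (rule add_hom_finsum[OF bimodule_abelian_group[OF P] bimodule_abelian_group[OF M]])
    show "(\<lambda>w. w j) \<in> hom (add_monoid ?P) (add_monoid M)" using that(1) by (auto simp: hom_def)
  qed (use that in auto)
  have split: "?split" if h: "h \<in> bimodule_hom R S N ?P" and p: "p \<in> bimodule_hom R S ?P N"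
    and ph: "\<And>x. x \<in> carrier N \<Longrightarrow> p (h x) = x" for h p
  proof -
    note hD = bimodule_homD[OF h] and pD = bimodule_homD[OF p]
    \<comment> \<open>The inclusion of the \<open>i\<close>-th coordinate, so that \<open>w = \<Sum>\<^sub>i e i (w i)\<close> in \<open>M\<^sup>q\<close>.\<close>
    define e where "e i m = (\<lambda>j\<in>{..<q}. if j = i then m else \<zero>\<^bsub>M\<^esub>)" for i m
    have e: "e i \<in> bimodule_hom R S M ?P" for i
      by (rule bimodule_homI) (auto simp: e_def fun_eq_iff M.lsmult_zero M.rsmult_zero)
    have eP: "e i m \<in> carrier ?P" if "m \<in> carrier M" for i m using bimodule_homD(2)[OF e that] .
    have hx: "h x i \<in> carrier M" if "x \<in> carrier N" "i < q" for x i
      using hD(2)[OF that(1)] that(2) by auto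
    have "(\<lambda>x. h x i) \<in> bimodule_hom R S N M" if "i < q" for i
      by (rule bimodule_homI) (simp_all add: hD hx that)
    moreover have "(\<lambda>m. p (e i m)) \<in> bimodule_hom R S M N" for i
      by (rule bimodule_hom_compose[OF e p])
    moreover have "(\<Oplus>\<^bsub>N\<^esub>i\<in>{..<q}. p (e i (h x i))) = x" if x: "x \<in> carrier N" for x
    proof -
      have c: "e i (h x i) \<in> carrier ?P" if "i < q" for i using eP hx[OF x that] .
      have "(\<Oplus>\<^bsub>?P\<^esub>i\<in>{..<q}. e i (h x i)) = h x"
      proof
        fix j
        have sumP: "(\<Oplus>\<^bsub>?P\<^esub>i\<in>{..<q}. e i (h x i)) \<in> carrier ?P"
          by (rule P.finsum_closed) (use c in auto)
        show "(\<Oplus>\<^bsub>?P\<^esub>i\<in>{..<q}. e i (h x i)) j = h x j"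
        proof (cases "j < q")
          case True
          have "(\<Oplus>\<^bsub>?P\<^esub>i\<in>{..<q}. e i (h x i)) j = (\<Oplus>\<^bsub>M\<^esub>i\<in>{..<q}. e i (h x i) j)"
            by (rule sum_coord[OF True]) (use c in auto)
          also have "\<dots> = (\<Oplus>\<^bsub>M\<^esub>i\<in>{..<q}. if j = i then h x i else \<zero>\<^bsub>M\<^esub>)"
            using True hx[OF x] by (intro M.finsum_cong') (auto simp: e_def)
          also have "\<dots> = h x j"
            by (rule M.finsum_singleton) (use True hx[OF x] in auto)
          finally show ?thesis .
        next
          case False
          then show ?thesis using sumP hD(2)[OF x] by (auto simp: PiE_def extensional_def)
        qed
      qed
      then have "x = p (\<Oplus>\<^bsub>?P\<^esub>i\<in>{..<q}. e i (h x i))" using ph[OF x] by simp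
      also have "\<dots> = (\<Oplus>\<^bsub>N\<^esub>i\<in>{..<q}. p (e i (h x i)))"
        by (rule add_hom_finsum[OF bimodule_abelian_group[OF P] bimodule_abelian_group[OF N] pD(1)])
          (use c in auto)
      finally show ?thesis by simp
    qed
    ultimately show ?split by (intro exI[where x = "\<lambda>i m. p (e i m)"] exI[where x = "\<lambda>i x. h x i"]) simp
  qed
  have retract: "\<exists>h \<in> bimodule_hom R S N ?P. \<exists>p \<in> bimodule_hom R S ?P N. \<forall>x \<in> carrier N. p (h x) = x"
    if f: "\<And>i. i < q \<Longrightarrow> f i \<in> bimodule_hom R S M N" and g: "\<And>i. i < q \<Longrightarrow> g i \<in> bimodule_hom R S N M"
      and fg: "\<And>x. x \<in> carrier N \<Longrightarrow> (\<Oplus>\<^bsub>N\<^esub>i\<in>{..<q}. f i (g i x)) = x" for f g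
  proof (intro bexI ballI)
    note fD = bimodule_homD[OF f] and gD = bimodule_homD[OF g]
    show "(\<lambda>x. \<lambda>i\<in>{..<q}. g i x) \<in> bimodule_hom R S N ?P"
      by (rule bimodule_homI) (auto simp: gD fun_eq_iff)
    have wc: "w i \<in> carrier M" if "i < q" "w \<in> {..<q} \<rightarrow>\<^sub>E carrier M" for i w
      using that by auto
    have fc: "f i (w i) \<in> carrier N" if "i < q" "w \<in> {..<q} \<rightarrow>\<^sub>E carrier M" for i w
      using fD(2) wc that by blast
    have sum_hom: "t (\<Oplus>\<^bsub>N\<^esub>i\<in>{..<q}. f i (w i)) = (\<Oplus>\<^bsub>N\<^esub>i\<in>{..<q}. t (f i (w i)))"
      if "t \<in> hom (add_monoid N) (add_monoid N)" "w \<in> carrier ?P" for t w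
      by (rule add_hom_finsum[OF bimodule_abelian_group[OF N] bimodule_abelian_group[OF N] that(1)])
        (use that(2) fc in auto)
    show "(\<lambda>w. \<Oplus>\<^bsub>N\<^esub>i\<in>{..<q}. f i (w i)) \<in> bimodule_hom R S ?P N"
    proof (rule bimodule_homI)
      show "(\<Oplus>\<^bsub>N\<^esub>i\<in>{..<q}. f i (w i)) \<in> carrier N" if "w \<in> carrier ?P" for w
        by (rule N.finsum_closed) (use fc that in auto)
    next
      fix v w assume v: "v \<in> carrier ?P" and w: "w \<in> carrier ?P"
      have "(\<Oplus>\<^bsub>N\<^esub>i\<in>{..<q}. f i ((v \<oplus>\<^bsub>?P\<^esub> w) i)) = (\<Oplus>\<^bsub>N\<^esub>i\<in>{..<q}. f i (v i) \<oplus>\<^bsub>N\<^esub> f i (w i))"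
        by (rule N.finsum_cong') (use v w in \<open>auto simp: fc wc fD(3)\<close>)
      then show "(\<Oplus>\<^bsub>N\<^esub>i\<in>{..<q}. f i ((v \<oplus>\<^bsub>?P\<^esub> w) i)) =
          (\<Oplus>\<^bsub>N\<^esub>i\<in>{..<q}. f i (v i)) \<oplus>\<^bsub>N\<^esub> (\<Oplus>\<^bsub>N\<^esub>i\<in>{..<q}. f i (w i))"
        using v w fc by (simp add: N.finsum_addf Pi_def)
    next
      fix r w assume r: "r \<in> carrier R" and w: "w \<in> carrier ?P"
      have "lsmult N r \<in> hom (add_monoid N) (add_monoid N)"
        using r N.lsmult_closed N.lsmult_r_distr by (auto simp: hom_def)
      note sum_hom[OF this w]
      moreover have "(\<Oplus>\<^bsub>N\<^esub>i\<in>{..<q}. f i (lsmult ?P r w i)) = (\<Oplus>\<^bsub>N\<^esub>i\<in>{..<q}. lsmult N r (f i (w i)))"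
        by (rule N.finsum_cong') (use r w in \<open>auto simp: fc wc N.lsmult_closed fD(4)\<close>)
      ultimately show "(\<Oplus>\<^bsub>N\<^esub>i\<in>{..<q}. f i (lsmult ?P r w i)) = lsmult N r (\<Oplus>\<^bsub>N\<^esub>i\<in>{..<q}. f i (w i))"
        by simp
    next
      fix s w assume s: "s \<in> carrier S" and w: "w \<in> carrier ?P"
      have "(\<lambda>x. rsmult N x s) \<in> hom (add_monoid N) (add_monoid N)"
        using s N.rsmult_closed N.rsmult_l_distr by (auto simp: hom_def)
      note sum_hom[OF this w]
      moreover have "(\<Oplus>\<^bsub>N\<^esub>i\<in>{..<q}. f i (rsmult ?P w s i)) = (\<Oplus>\<^bsub>N\<^esub>i\<in>{..<q}. rsmult N (f i (w i)) s)"
        by (rule N.finsum_cong') (use s w in \<open>auto simp: fc wc N.rsmult_closed fD(5)\<close>)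
      ultimately show "(\<Oplus>\<^bsub>N\<^esub>i\<in>{..<q}. f i (rsmult ?P w s i)) = rsmult N (\<Oplus>\<^bsub>N\<^esub>i\<in>{..<q}. f i (w i)) s"
        by simp
    qed
  next
    fix x assume x: "x \<in> carrier N"
    have "(\<Oplus>\<^bsub>N\<^esub>i\<in>{..<q}. f i ((\<lambda>i\<in>{..<q}. g i x) i)) = (\<Oplus>\<^bsub>N\<^esub>i\<in>{..<q}. f i (g i x))"
      by (rule N.finsum_cong') (use x bimodule_homD(2)[OF f] bimodule_homD(2)[OF g] in auto)
    then show "(\<Oplus>\<^bsub>N\<^esub>i\<in>{..<q}. f i ((\<lambda>i\<in>{..<q}. g i x) i)) = x" using fg[OF x] by simp
  qed
  show ?thesis
    unfolding summand_of_power_def direct_summand_iff_retract[OF P N]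
  proof
    assume "\<exists>h \<in> bimodule_hom R S N ?P. \<exists>p \<in> bimodule_hom R S ?P N. \<forall>x \<in> carrier N. p (h x) = x"
    then obtain h p where h: "h \<in> bimodule_hom R S N ?P" and p: "p \<in> bimodule_hom R S ?P N"
      and ph: "\<forall>x \<in> carrier N. p (h x) = x" by (elim bexE)
    show ?split by (rule split[OF h p bspec[OF ph]])
  next
    assume ?split
    then obtain f g where "\<forall>i<q. f i \<in> bimodule_hom R S M N \<and> g i \<in> bimodule_hom R S N M"
      and "\<forall>x \<in> carrier N. (\<Oplus>\<^bsub>N\<^esub>i\<in>{..<q}. f i (g i x)) = x" by (elim exE conjE)
    then show "\<exists>h \<in> bimodule_hom R S N ?P. \<exists>p \<in> bimodule_hom R S ?P N. \<forall>x \<in> carrier N. p (h x) = x"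
      by (intro retract[of f g]) simp_all
  qed
qed

section \<open>The universal property of the tensor powers\<close>

lemma hom_eq_on_generate:
  assumes G: "group G" and H: "group H" and h: "h \<in> hom G H" and k: "k \<in> hom G H"
    and S: "S \<subseteq> carrier G" and eq: "\<And>x. x \<in> S \<Longrightarrow> h x = k x" and x: "x \<in> generate G S"
  shows "h x = k x"
proof -
  interpret h: group_hom G H h using G H h by (simp add: group_hom_def group_hom_axioms_def)
  interpret k: group_hom G H k using G H k by (simp add: group_hom_def group_hom_axioms_def)
  from x show ?thesis
  proof induction
    case (eng x y)
    then have "x \<in> carrier G" "y \<in> carrier G"
      using h.G.generate_in_carrier[OF S] by auto
    then show ?case using eng by simp
  qed (use eq S in auto)
qed

definition pure_tensor ::
  "('a, 'r) ring_scheme \<Rightarrow> 'a set \<Rightarrow> nat \<Rightarrow> 'a list \<Rightarrow> ('a list \<Rightarrow>\<^sub>0 int) set" where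
  "pure_tensor A B n xs = tensor_kernel A B n #>\<^bsub>free_Abelian_group (tuples A n)\<^esub> frag_of xs"

text \<open>The target is a multiplicative monoid record, which covers both the quotient group \<open>tensor_group\<close> and
  the additive monoid of a bimodule.\<close>

definition balanced_map ::
  "('a, 'r) ring_scheme \<Rightarrow> 'a set \<Rightarrow> nat \<Rightarrow> ('g, 'h) monoid_scheme \<Rightarrow> ('a list \<Rightarrow> 'g) \<Rightarrow> bool" where
  "balanced_map A B n G \<phi> \<longleftrightarrow> \<phi> \<in> tuples A n \<rightarrow> carrier G \<and>
    (\<forall>xs x y ys. xs @ x # ys \<in> tuples A n \<longrightarrow> y \<in> carrier A \<longrightarrow>
      \<phi> (xs @ (x \<oplus>\<^bsub>A\<^esub> y) # ys) = \<phi> (xs @ x # ys) \<otimes>\<^bsub>G\<^esub> \<phi> (xs @ y # ys)) \<and>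
    (\<forall>xs x b y ys. xs @ x # y # ys \<in> tuples A n \<longrightarrow> b \<in> B \<longrightarrow>
      \<phi> (xs @ (x \<otimes>\<^bsub>A\<^esub> b) # y # ys) = \<phi> (xs @ x # (b \<otimes>\<^bsub>A\<^esub> y) # ys))"

lemma balanced_mapI:
  assumes "\<And>xs. xs \<in> tuples A n \<Longrightarrow> \<phi> xs \<in> carrier G"
    and "\<And>xs x y ys. \<lbrakk>xs @ x # ys \<in> tuples A n; y \<in> carrier A\<rbrakk> \<Longrightarrow>
      \<phi> (xs @ (x \<oplus>\<^bsub>A\<^esub> y) # ys) = \<phi> (xs @ x # ys) \<otimes>\<^bsub>G\<^esub> \<phi> (xs @ y # ys)"
    and "\<And>xs x b y ys. \<lbrakk>xs @ x # y # ys \<in> tuples A n; b \<in> B\<rbrakk> \<Longrightarrow>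
      \<phi> (xs @ (x \<otimes>\<^bsub>A\<^esub> b) # y # ys) = \<phi> (xs @ x # (b \<otimes>\<^bsub>A\<^esub> y) # ys)"
  shows "balanced_map A B n G \<phi>"
  using assms by (auto simp: balanced_map_def)

lemma balanced_mapD:
  assumes "balanced_map A B n G \<phi>"
  shows "xs \<in> tuples A n \<Longrightarrow> \<phi> xs \<in> carrier G"
    and "\<lbrakk>xs @ x # ys \<in> tuples A n; y \<in> carrier A\<rbrakk> \<Longrightarrow>
      \<phi> (xs @ (x \<oplus>\<^bsub>A\<^esub> y) # ys) = \<phi> (xs @ x # ys) \<otimes>\<^bsub>G\<^esub> \<phi> (xs @ y # ys)"
    and "\<lbrakk>xs @ x # y # ys \<in> tuples A n; b \<in> B\<rbrakk> \<Longrightarrow>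
      \<phi> (xs @ (x \<otimes>\<^bsub>A\<^esub> b) # y # ys) = \<phi> (xs @ x # (b \<otimes>\<^bsub>A\<^esub> y) # ys)"
  using assms by (auto simp: balanced_map_def)

locale ring_extension = A: ring A for A :: "('a, 'r) ring_scheme" (structure) and B :: "'a set" +
  assumes subring_B: "subring B A"
begin

lemma B_carrier: "b \<in> B \<Longrightarrow> b \<in> carrier A"
  using subringE(1)[OF subring_B] by blast

lemma tuples_simps [simp]:
  "[] \<in> tuples A n \<longleftrightarrow> n = 0"
  "x # xs \<in> tuples A (Suc n) \<longleftrightarrow> x \<in> carrier A \<and> xs \<in> tuples A n"
  by (auto simp: tuples_def)

lemma tensor_relators_carrier: "tensor_relators A B n \<subseteq> carrier (free_Abelian_group (tuples A n))"
proof
  let ?F = "free_Abelian_group (tuples A n)"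
  interpret F: comm_group ?F by (rule abelian_free_Abelian_group)
  have minus: "c - d \<in> carrier ?F" if "c \<in> carrier ?F" "d \<in> carrier ?F" for c d
    using that keys_diff[of c d] by auto
  fix c assume "c \<in> tensor_relators A B n"
  then show "c \<in> carrier ?F"
    by (auto simp: tensor_relators_def simp del: carrier_free_Abelian_group_iff intro!: minus)
      (auto simp: tuples_def B_carrier)
qed

lemma tensor_kernel_subgroup: "subgroup (tensor_kernel A B n) (free_Abelian_group (tuples A n))"
  unfolding tensor_kernel_def
  by (intro group.generate_is_subgroup tensor_relators_carrier) simp

lemma tensor_kernel_normal: "tensor_kernel A B n \<lhd> free_Abelian_group (tuples A n)"
  by (rule comm_group.subgroup_imp_normal[OF abelian_free_Abelian_group tensor_kernel_subgroup])

lemma tensor_group_comm_group: "comm_group (tensor_group A B n)"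
  unfolding tensor_group_def
  by (rule comm_group.abelian_FactGroup[OF abelian_free_Abelian_group tensor_kernel_subgroup])

lemma quotient_hom:
  "(\<lambda>c. tensor_kernel A B n #>\<^bsub>free_Abelian_group (tuples A n)\<^esub> c)
    \<in> hom (free_Abelian_group (tuples A n)) (tensor_group A B n)"
  unfolding tensor_group_def by (rule normal.r_coset_hom_Mod[OF tensor_kernel_normal])

lemma pure_tensor_closed [simp]: "xs \<in> tuples A n \<Longrightarrow> pure_tensor A B n xs \<in> carrier (tensor_group A B n)"
  using hom_in_carrier[OF quotient_hom, of "frag_of xs" n] by (simp add: pure_tensor_def)

lemma tensor_group_generate:
  "carrier (tensor_group A B n) = generate (tensor_group A B n) (pure_tensor A B n ` tuples A n)"
proof
  let ?F = "free_Abelian_group (tuples A n)" and ?T = "tensor_group A B n"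
  let ?q = "\<lambda>c. tensor_kernel A B n #>\<^bsub>?F\<^esub> c"
  interpret T: comm_group ?T by (rule tensor_group_comm_group)
  interpret q: group_hom ?F ?T ?q
    by (simp add: group_hom_def group_hom_axioms_def T.is_group quotient_hom)
  have sub: "subgroup (generate ?T (pure_tensor A B n ` tuples A n)) ?T"
    by (rule T.generate_is_subgroup) auto
  have "?q c \<in> generate ?T (pure_tensor A B n ` tuples A n)" if "c \<in> carrier ?F" for c
  proof -
    have "Poly_Mapping.keys c \<subseteq> tuples A n" using that by simp
    then show ?thesis
    proof (induction c rule: free_Abelian_group_induct[consumes 1, case_names zero diff frag])
      case zero
      then show ?case using q.hom_one generate.one[of ?T] by simp
    next
      case (diff a b)
      then have c: "a \<in> carrier ?F" "b \<in> carrier ?F" by auto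
      then have "a - b = a \<otimes>\<^bsub>?F\<^esub> inv\<^bsub>?F\<^esub> b" by simp
      then have "?q (a - b) = ?q a \<otimes>\<^bsub>?T\<^esub> inv\<^bsub>?T\<^esub> ?q b"
        using c by (simp only: q.hom_mult q.hom_inv q.G.inv_closed)
      then show ?case using diff subgroup.m_closed[OF sub] subgroup.m_inv_closed[OF sub] by metis
    next
      case (frag xs)
      then show ?case by (auto simp: pure_tensor_def intro!: generate.incl)
    qed
  qed
  then show "carrier ?T \<subseteq> generate ?T (pure_tensor A B n ` tuples A n)"
    by (auto simp: tensor_group_def carrier_FactGroup)
  show "generate ?T (pure_tensor A B n ` tuples A n) \<subseteq> carrier ?T"
    by (rule T.generate_incl) auto
qed

lemma tensor_group_hom_eq:
  assumes "group H" "h \<in> hom (tensor_group A B n) H" "k \<in> hom (tensor_group A B n) H"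
    and "\<And>xs. xs \<in> tuples A n \<Longrightarrow> h (pure_tensor A B n xs) = k (pure_tensor A B n xs)"
    and "X \<in> carrier (tensor_group A B n)"
  shows "h X = k X"
  by (rule hom_eq_on_generate[OF _ assms(1-3), where S = "pure_tensor A B n ` tuples A n"])
    (use assms(4,5) tensor_group_generate[symmetric] tensor_group_comm_group
      in \<open>auto simp: comm_group_def\<close>)

text \<open>The relators were chosen so that killing them is the same as being additive in each slot and
  balanced between slots. A homomorphism that kills them agrees on them with the trivial one, hence
  also on the subgroup that they generate.\<close>

lemma hom_kernel_relators:
  assumes "comm_group G" "h \<in> hom (free_Abelian_group (tuples A n)) G"
    and "balanced_map A B n G (\<lambda>xs. h (frag_of xs))"
    and "c \<in> tensor_kernel A B n"
  shows "h c = \<one>\<^bsub>G\<^esub>"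
proof -
  let ?F = "free_Abelian_group (tuples A n)"
  interpret G: comm_group G by (rule assms)
  interpret F: comm_group ?F by (rule abelian_free_Abelian_group)
  interpret h: group_hom ?F G h
    by (simp add: group_hom_def group_hom_axioms_def G.is_group assms(2))
  note bal = balanced_mapD[OF assms(3)]
  have hfrag: "h (c - d) = h c \<otimes>\<^bsub>G\<^esub> inv\<^bsub>G\<^esub> h d" if "c \<in> carrier ?F" "d \<in> carrier ?F" for c d
  proof -
    have "c - d = c \<otimes>\<^bsub>?F\<^esub> inv\<^bsub>?F\<^esub> d" using that by simp
    then show ?thesis using that by (simp only: h.hom_mult h.hom_inv F.inv_closed)
  qed
  have one: "h r = \<one>\<^bsub>G\<^esub>" if "r \<in> tensor_relators A B n" for r
    using that unfolding tensor_relators_def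
  proof (elim UnE CollectE exE conjE)
    fix xs x y ys
    assume r: "r = frag_of (xs @ (x \<oplus> y) # ys) - frag_of (xs @ x # ys) - frag_of (xs @ y # ys)"
      and t: "xs @ x # ys \<in> tuples A n" and y: "y \<in> carrier A"
    have t': "xs @ (x \<oplus> y) # ys \<in> tuples A n" "xs @ y # ys \<in> tuples A n"
      using t y by (auto simp: tuples_def)
    have c: "frag_of (xs @ (x \<oplus> y) # ys) - frag_of (xs @ x # ys) \<in> carrier ?F"
      using t t' keys_diff[of "frag_of (xs @ (x \<oplus> y) # ys)" "frag_of (xs @ x # ys)"] by auto
    have "h r = (h (frag_of (xs @ x # ys)) \<otimes>\<^bsub>G\<^esub> h (frag_of (xs @ y # ys))) \<otimes>\<^bsub>G\<^esub>
        inv\<^bsub>G\<^esub> h (frag_of (xs @ x # ys)) \<otimes>\<^bsub>G\<^esub> inv\<^bsub>G\<^esub> h (frag_of (xs @ y # ys))"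
      using t t' c bal(2)[OF t y] by (simp add: r hfrag del: carrier_free_Abelian_group_iff)
    then show ?thesis
      using bal(1)[OF t] bal(1)[OF t'(2)]
      by (metis G.inv_closed G.inv_solve_right' G.m_assoc G.m_closed G.m_comm G.r_inv)
  next
    fix xs x b y ys
    assume r: "r = frag_of (xs @ (x \<otimes> b) # y # ys) - frag_of (xs @ x # (b \<otimes> y) # ys)"
      and t: "xs @ x # y # ys \<in> tuples A n" and b: "b \<in> B"
    have t': "xs @ (x \<otimes> b) # y # ys \<in> tuples A n" "xs @ x # (b \<otimes> y) # ys \<in> tuples A n"
      using t b by (auto simp: tuples_def B_carrier)
    show ?thesis
      using t' bal(3)[OF t b] bal(1)[OF t'(2)]
      by (simp add: r hfrag del: carrier_free_Abelian_group_iff)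
  qed
  have "(\<lambda>_. \<one>\<^bsub>G\<^esub>) \<in> hom ?F G" by (simp add: hom_def)
  from hom_eq_on_generate[OF F.is_group G.is_group assms(2) this tensor_relators_carrier one]
  show ?thesis using assms(4) by (simp add: tensor_kernel_def)
qed

text \<open>From here on every map out of \<open>C\<^sub>n(A, B)\<close> is defined by its values on pure tensors, by this
  theorem, and every equation between such maps is checked on pure tensors, by
  \<open>tensor_group_hom_eq\<close>. Once the relations between pure tensors and the scalar multiplications are
  expressed in the same way, cosets and the free abelian group are no longer needed.\<close>

theorem tensor_group_universal:
  assumes G: "comm_group G" and bal: "balanced_map A B n G \<phi>"
  shows "\<exists>h \<in> hom (tensor_group A B n) G. \<forall>xs \<in> tuples A n. h (pure_tensor A B n xs) = \<phi> xs"
proof -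
  let ?F = "free_Abelian_group (tuples A n)"
  interpret G: comm_group G by (rule G)
  have "\<phi> ` tuples A n \<subseteq> carrier G" using balanced_mapD(1)[OF bal] by auto
  then obtain k where k: "k \<in> hom ?F G" and k_frag: "\<And>xs. xs \<in> tuples A n \<Longrightarrow> k (frag_of xs) = \<phi> xs"
    using G.free_Abelian_group_universal by blast
  interpret k: group_hom ?F G k
    by (simp add: group_hom_def group_hom_axioms_def G.is_group k)
  have bal_k: "balanced_map A B n G (\<lambda>xs. k (frag_of xs))"
  proof (rule balanced_mapI)
    show "k (frag_of xs) \<in> carrier G" if "xs \<in> tuples A n" for xs
      using that balanced_mapD(1)[OF bal] k_frag by simp
  next
    fix xs x y ys assume t: "xs @ x # ys \<in> tuples A n" and y: "y \<in> carrier A"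
    have "xs @ (x \<oplus> y) # ys \<in> tuples A n" "xs @ y # ys \<in> tuples A n"
      using t y by (auto simp: tuples_def)
    then show "k (frag_of (xs @ (x \<oplus> y) # ys)) = k (frag_of (xs @ x # ys)) \<otimes>\<^bsub>G\<^esub> k (frag_of (xs @ y # ys))"
      using balanced_mapD(2)[OF bal t y] t k_frag by simp
  next
    fix xs x b y ys assume t: "xs @ x # y # ys \<in> tuples A n" and b: "b \<in> B"
    have "xs @ (x \<otimes> b) # y # ys \<in> tuples A n" "xs @ x # (b \<otimes> y) # ys \<in> tuples A n"
      using t b by (auto simp: tuples_def B_carrier)
    then show "k (frag_of (xs @ (x \<otimes> b) # y # ys)) = k (frag_of (xs @ x # (b \<otimes> y) # ys))"
      using balanced_mapD(3)[OF bal t b] k_frag by simp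
  qed
  have "tensor_kernel A B n \<subseteq> kernel ?F G k"
    using hom_kernel_relators[OF G k bal_k] subgroup.subset[OF tensor_kernel_subgroup[of n]]
    unfolding kernel_def by blast
  from k.FactGroup_universal_kernel[OF tensor_kernel_normal this]
  obtain h where "h \<in> hom (tensor_group A B n) G"
    "\<And>c. c \<in> carrier ?F \<Longrightarrow> h (tensor_kernel A B n #>\<^bsub>?F\<^esub> c) = k c"
    unfolding tensor_group_def by metis
  then show ?thesis using k_frag by (intro bexI[of _ h]) (auto simp: pure_tensor_def)
qed

lemma pure_tensor_balanced: "balanced_map A B n (tensor_group A B n) (pure_tensor A B n)"
proof -
  let ?F = "free_Abelian_group (tuples A n)" and ?K = "tensor_kernel A B n" and ?T = "tensor_group A B n"
  interpret F: comm_group ?F by (rule abelian_free_Abelian_group)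
  interpret T: comm_group ?T by (rule tensor_group_comm_group)
  have coset_eq: "?K #>\<^bsub>?F\<^esub> c = ?K #>\<^bsub>?F\<^esub> d" if "c - d \<in> ?K" "c \<in> carrier ?F" "d \<in> carrier ?F" for c d
  proof -
    have "c \<in> ?K #>\<^bsub>?F\<^esub> d" using that by (auto simp: r_coset_def intro!: bexI[of _ "c - d"])
    then show ?thesis using F.repr_independence[OF _ that(3) tensor_kernel_subgroup] by simp
  qed
  show ?thesis
  proof (rule balanced_mapI)
    fix xs x y ys assume t: "xs @ x # ys \<in> tuples A n" and y: "y \<in> carrier A"
    have t': "xs @ (x \<oplus> y) # ys \<in> tuples A n" "xs @ y # ys \<in> tuples A n"
      using t y by (auto simp: tuples_def)
    have "frag_of (xs @ (x \<oplus> y) # ys) - (frag_of (xs @ x # ys) + frag_of (xs @ y # ys)) \<in> ?K"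
      using t y unfolding tensor_kernel_def diff_diff_eq[symmetric]
      by (intro generate.incl) (auto simp: tensor_relators_def)
    then have "?K #>\<^bsub>?F\<^esub> frag_of (xs @ (x \<oplus> y) # ys) = ?K #>\<^bsub>?F\<^esub> (frag_of (xs @ x # ys) \<otimes>\<^bsub>?F\<^esub> frag_of (xs @ y # ys))"
      using t t' F.m_closed[of "frag_of (xs @ x # ys)" "frag_of (xs @ y # ys)"]
      by (intro coset_eq) (simp_all del: carrier_free_Abelian_group_iff)
    also have "\<dots> = pure_tensor A B n (xs @ x # ys) \<otimes>\<^bsub>?T\<^esub> pure_tensor A B n (xs @ y # ys)"
      unfolding pure_tensor_def
      by (rule hom_mult[OF quotient_hom]) (use t t' in auto)
    finally show "pure_tensor A B n (xs @ (x \<oplus> y) # ys) =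
        pure_tensor A B n (xs @ x # ys) \<otimes>\<^bsub>?T\<^esub> pure_tensor A B n (xs @ y # ys)"
      by (simp add: pure_tensor_def)
  next
    fix xs x b y ys assume t: "xs @ x # y # ys \<in> tuples A n" and b: "b \<in> B"
    have t': "xs @ (x \<otimes> b) # y # ys \<in> tuples A n" "xs @ x # (b \<otimes> y) # ys \<in> tuples A n"
      using t b by (auto simp: tuples_def B_carrier)
    have "frag_of (xs @ (x \<otimes> b) # y # ys) - frag_of (xs @ x # (b \<otimes> y) # ys) \<in> ?K"
      using t b unfolding tensor_kernel_def
      by (intro generate.incl) (auto simp: tensor_relators_def)
    then show "pure_tensor A B n (xs @ (x \<otimes> b) # y # ys) = pure_tensor A B n (xs @ x # (b \<otimes> y) # ys)"
      unfolding pure_tensor_def by (intro coset_eq) (use t' in auto)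
  qed simp
qed

text \<open>The scalar multiplications of \<open>tensor_power\<close> are formed by \<open>tensor_induced\<close>, which is written with
  cosets; this lemma gives the description on pure tensors that determines them.\<close>

lemma tensor_induced_pure:
  assumes g: "\<And>xs. xs \<in> tuples A n \<Longrightarrow> g xs \<in> tuples A n"
    and bal: "balanced_map A B n (tensor_group A B n) (\<lambda>xs. pure_tensor A B n (g xs))"
  shows "tensor_induced A B n g \<in> hom (tensor_group A B n) (tensor_group A B n)"
    and "xs \<in> tuples A n \<Longrightarrow> tensor_induced A B n g (pure_tensor A B n xs) = pure_tensor A B n (g xs)"
proof -
  let ?F = "free_Abelian_group (tuples A n)" and ?K = "tensor_kernel A B n" and ?T = "tensor_group A B n"
  let ?e = "frag_extend (frag_of \<circ> g)" and ?q = "\<lambda>c. tensor_kernel A B n #>\<^bsub>free_Abelian_group (tuples A n)\<^esub> c"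
  interpret F: comm_group ?F by (rule abelian_free_Abelian_group)
  interpret K: subgroup ?K ?F by (rule tensor_kernel_subgroup)
  have keys: "?e c \<in> carrier ?F" if "c \<in> carrier ?F" for c
    using that g keys_frag_extend[of "frag_of \<circ> g" c] by fastforce
  have e: "?e \<in> hom ?F ?F" using keys by (auto simp: hom_def frag_extend_add)
  have qe: "?q \<circ> ?e \<in> hom ?F ?T" by (rule hom_compose[OF e quotient_hom])
  have Ke: "?e c \<in> ?K" if c: "c \<in> ?K" for c
  proof -
    have "?q (?e c) = \<one>\<^bsub>?T\<^esub>"
      using hom_kernel_relators[OF tensor_group_comm_group qe _ c] bal by (simp add: pure_tensor_def)
    then have "?q (?e c) = ?K" by (simp add: tensor_group_def)
    moreover have "?e c \<in> ?q (?e c)"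
      by (rule F.rcos_self[OF _ tensor_kernel_subgroup]) (use c keys K.subset in blast)
    ultimately show ?thesis by simp
  qed
  have ind: "tensor_induced A B n g (?q c) = ?q (?e c)" if c: "c \<in> carrier ?F" for c
  proof -
    have "?e ` (?q c) \<subseteq> ?q (?e c)"
      using Ke by (auto simp: r_coset_def frag_extend_add)
    then have "?K <#>\<^bsub>?F\<^esub> ?e ` (?q c) \<subseteq> ?K <#>\<^bsub>?F\<^esub> ?q (?e c)"
      unfolding set_mult_def by blast
    moreover have "?e c \<in> ?e ` (?q c)"
      using F.rcos_self[OF c tensor_kernel_subgroup] by blast
    then have "?q (?e c) \<subseteq> ?K <#>\<^bsub>?F\<^esub> ?e ` (?q c)"
      unfolding set_mult_def r_coset_def by blast
    moreover have "?K <#>\<^bsub>?F\<^esub> ?q (?e c) = ?q (?e c)"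
      by (rule normal.rcosets_mult_eq[OF tensor_kernel_normal]) (use keys[OF c] in \<open>auto simp: RCOSETS_def\<close>)
    ultimately show ?thesis
      unfolding tensor_induced_def by (metis subset_antisym)
  qed
  show "tensor_induced A B n g (pure_tensor A B n xs) = pure_tensor A B n (g xs)" if "xs \<in> tuples A n"
    using ind[of "frag_of xs"] that by (simp add: pure_tensor_def)
  show "tensor_induced A B n g \<in> hom ?T ?T"
  proof -
    have car: "carrier ?T = ?q ` carrier ?F" by (simp add: tensor_group_def carrier_FactGroup)
    have qT: "?q (?e c) \<in> carrier ?T" if "c \<in> carrier ?F" for c
      using hom_in_carrier[OF quotient_hom keys[OF that]] .
    have "tensor_induced A B n g (?q c \<otimes>\<^bsub>?T\<^esub> ?q d)
        = tensor_induced A B n g (?q c) \<otimes>\<^bsub>?T\<^esub> tensor_induced A B n g (?q d)"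
      if "c \<in> carrier ?F" "d \<in> carrier ?F" for c d
      using that by (simp only: hom_mult[OF quotient_hom, symmetric] hom_mult[OF e] ind keys F.m_closed)
    then show ?thesis using car qT ind by (auto simp: hom_def simp del: carrier_free_Abelian_group_iff)
  qed
qed

end

section \<open>The tensor powers as bimodules\<close>

lemma bimodule_restrict:
  assumes M: "bimodule R S M" and P: "subring P R" and Q: "subring Q S"
  shows "bimodule (R\<lparr>carrier := P\<rparr>) (S\<lparr>carrier := Q\<rparr>) M"
proof -
  interpret M: bimodule R S M by (rule M)
  have "x \<in> carrier R" if "x \<in> P" for x using subringE(1)[OF P] that by blast
  moreover have "x \<in> carrier S" if "x \<in> Q" for x using subringE(1)[OF Q] that by blast
  ultimately show ?thesis
    by (intro bimodule.intro bimodule_axioms.intro M.R.subring_is_ring[OF P]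
          M.S.subring_is_ring[OF Q] bimodule_abelian_group[OF M])
      (simp_all add: M.lsmult_closed M.rsmult_closed M.lsmult_l_distr M.lsmult_r_distr
        M.rsmult_l_distr M.rsmult_r_distr M.lsmult_assoc M.rsmult_assoc M.lsmult_one M.rsmult_one
        M.smult_commute)
qed

lemma bimodule_hom_mono:
  assumes "carrier R' \<subseteq> carrier R" "carrier S' \<subseteq> carrier S"
  shows "bimodule_hom R S M N \<subseteq> bimodule_hom R' S' M N"
  using assms by (auto simp: bimodule_hom_def)

lemma summand_of_power_restrict:
  assumes "bimodule R S M" "bimodule R S N" "summand_of_power R S N M q"
    and "bimodule R' S' M" "bimodule R' S' N" "carrier R' \<subseteq> carrier R" "carrier S' \<subseteq> carrier S"
  shows "summand_of_power R' S' N M q"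
proof -
  note mono = subsetD[OF bimodule_hom_mono[OF assms(6,7)]]
  obtain f g where "\<forall>i<q. f i \<in> bimodule_hom R S M N \<and> g i \<in> bimodule_hom R S N M"
    and "\<forall>x \<in> carrier N. (\<Oplus>\<^bsub>N\<^esub>i\<in>{..<q}. f i (g i x)) = x"
    using assms(3) unfolding summand_of_power_iff[OF assms(1,2)] by (elim exE conjE)
  then show ?thesis
    unfolding summand_of_power_iff[OF assms(4,5)]
    by (intro exI[where x = f] exI[where x = g]) (simp add: mono)
qed

lemma hom_pointwise_mult:
  assumes "comm_group G" "h \<in> hom H G" "k \<in> hom H G"
  shows "(\<lambda>x. h x \<otimes>\<^bsub>G\<^esub> k x) \<in> hom H G"
proof -
  interpret comm_group G by (rule assms)
  have "h x \<in> carrier G" "k x \<in> carrier G" if "x \<in> carrier H" for x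
    using assms(2,3) that by (auto simp: hom_def)
  then show ?thesis using assms(2,3) by (auto simp: hom_def m_ac)
qed

lemma tensor_power_sel [simp]:
  "carrier (tensor_power A B n) = carrier (tensor_group A B n)"
  "ring.add (tensor_power A B n) = monoid.mult (tensor_group A B n)"
  "ring.zero (tensor_power A B n) = \<one>\<^bsub>tensor_group A B n\<^esub>"
  by (simp_all add: tensor_power_def)

lemma hom_tensor_power [simp]:
  "hom (add_monoid (tensor_power A B n)) G = hom (tensor_group A B n) G"
  "hom G (add_monoid (tensor_power A B n)) = hom G (tensor_group A B n)"
  by (simp_all add: hom_def)

context ring_extension
begin

lemmas pure_tensor_add = balanced_mapD(2)[OF pure_tensor_balanced]
  and pure_tensor_balance = balanced_mapD(3)[OF pure_tensor_balanced]

lemma tensor_group_is_group: "group (tensor_group A B n)"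
  using tensor_group_comm_group by (simp add: comm_group_def)

lemma tuples_append:
  "xs @ x # ys \<in> tuples A n \<longleftrightarrow> set xs \<subseteq> carrier A \<and> x \<in> carrier A \<and> set ys \<subseteq> carrier A \<and>
    length xs + length ys + 1 = n"
  by (auto simp: tuples_def)

lemma lsmult_balanced:
  assumes a: "a \<in> carrier A"
  shows "balanced_map A B (Suc n) (tensor_group A B (Suc n))
    (\<lambda>xs. pure_tensor A B (Suc n) ((a \<otimes> hd xs) # tl xs))"
proof (rule balanced_mapI)
  fix xs assume "xs \<in> tuples A (Suc n)"
  then show "pure_tensor A B (Suc n) ((a \<otimes> hd xs) # tl xs) \<in> carrier (tensor_group A B (Suc n))"
    using a by (cases xs) auto
next
  fix xs x y ys assume t: "xs @ x # ys \<in> tuples A (Suc n)" and y: "y \<in> carrier A"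
  show "pure_tensor A B (Suc n) ((a \<otimes> hd (xs @ (x \<oplus> y) # ys)) # tl (xs @ (x \<oplus> y) # ys)) =
      pure_tensor A B (Suc n) ((a \<otimes> hd (xs @ x # ys)) # tl (xs @ x # ys)) \<otimes>\<^bsub>tensor_group A B (Suc n)\<^esub>
      pure_tensor A B (Suc n) ((a \<otimes> hd (xs @ y # ys)) # tl (xs @ y # ys))"
  proof (cases xs)
    case Nil
    then show ?thesis
      using t y a pure_tensor_add[of "[]" "a \<otimes> x" ys "Suc n" "a \<otimes> y"] by (simp add: A.r_distr)
  next
    case (Cons z zs)
    then show ?thesis
      using t y a pure_tensor_add[of "(a \<otimes> z) # zs" x ys "Suc n" y] by simp
  qed
next
  fix xs x b y ys assume t: "xs @ x # y # ys \<in> tuples A (Suc n)" and b: "b \<in> B"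
  show "pure_tensor A B (Suc n) ((a \<otimes> hd (xs @ (x \<otimes> b) # y # ys)) # tl (xs @ (x \<otimes> b) # y # ys)) =
      pure_tensor A B (Suc n) ((a \<otimes> hd (xs @ x # (b \<otimes> y) # ys)) # tl (xs @ x # (b \<otimes> y) # ys))"
  proof (cases xs)
    case Nil
    then show ?thesis
      using t b a pure_tensor_balance[of "[]" "a \<otimes> x" y ys "Suc n" b] B_carrier[OF b]
      by (simp add: A.m_assoc)
  next
    case (Cons z zs)
    then show ?thesis
      using t b a pure_tensor_balance[of "(a \<otimes> z) # zs" x y ys "Suc n" b] by simp
  qed
qed

lemma rsmult_balanced:
  assumes a: "a \<in> carrier A"
  shows "balanced_map A B (Suc n) (tensor_group A B (Suc n))
    (\<lambda>xs. pure_tensor A B (Suc n) (butlast xs @ [last xs \<otimes> a]))"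
proof (rule balanced_mapI)
  fix xs assume "xs \<in> tuples A (Suc n)"
  then show "pure_tensor A B (Suc n) (butlast xs @ [last xs \<otimes> a]) \<in> carrier (tensor_group A B (Suc n))"
    using a by (cases xs rule: rev_cases) (auto simp: tuples_append)
next
  fix xs x y ys assume t: "xs @ x # ys \<in> tuples A (Suc n)" and y: "y \<in> carrier A"
  show "pure_tensor A B (Suc n) (butlast (xs @ (x \<oplus> y) # ys) @ [last (xs @ (x \<oplus> y) # ys) \<otimes> a]) =
      pure_tensor A B (Suc n) (butlast (xs @ x # ys) @ [last (xs @ x # ys) \<otimes> a]) \<otimes>\<^bsub>tensor_group A B (Suc n)\<^esub>
      pure_tensor A B (Suc n) (butlast (xs @ y # ys) @ [last (xs @ y # ys) \<otimes> a])"
  proof (cases ys rule: rev_cases)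
    case Nil
    then show ?thesis
      using t y a pure_tensor_add[of xs "x \<otimes> a" "[]" "Suc n" "y \<otimes> a"]
      by (simp add: A.l_distr tuples_append butlast_append)
  next
    case (snoc zs z)
    then show ?thesis
      using t y a pure_tensor_add[of xs x "zs @ [z \<otimes> a]" "Suc n" y]
      by (simp add: tuples_append butlast_append)
  qed
next
  fix xs x b y ys assume t: "xs @ x # y # ys \<in> tuples A (Suc n)" and b: "b \<in> B"
  show "pure_tensor A B (Suc n) (butlast (xs @ (x \<otimes> b) # y # ys) @ [last (xs @ (x \<otimes> b) # y # ys) \<otimes> a]) =
      pure_tensor A B (Suc n) (butlast (xs @ x # (b \<otimes> y) # ys) @ [last (xs @ x # (b \<otimes> y) # ys) \<otimes> a])"
  proof (cases ys rule: rev_cases)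
    case Nil
    then show ?thesis
      using t b a pure_tensor_balance[of xs x "y \<otimes> a" "[]" "Suc n" b] B_carrier[OF b]
      by (simp add: A.m_assoc tuples_append butlast_append)
  next
    case (snoc zs z)
    then show ?thesis
      using t b a pure_tensor_balance[of xs x y "zs @ [z \<otimes> a]" "Suc n" b]
      by (simp add: tuples_append butlast_append)
  qed
qed

lemma lsmult_pure_tensor:
  assumes "a \<in> carrier A" "x \<in> carrier A" "xs \<in> tuples A n"
  shows "lsmult (tensor_power A B (Suc n)) a (pure_tensor A B (Suc n) (x # xs)) =
    pure_tensor A B (Suc n) ((a \<otimes> x) # xs)"
proof -
  have "(a \<otimes> hd xs) # tl xs \<in> tuples A (Suc n)" if "xs \<in> tuples A (Suc n)" for xs
    using that assms(1) by (cases xs) auto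
  from tensor_induced_pure(2)[OF this lsmult_balanced, of "x # xs"] show ?thesis
    using assms by (simp add: tensor_power_def)
qed

lemma rsmult_pure_tensor:
  assumes "a \<in> carrier A" "x \<in> carrier A" "xs \<in> tuples A n"
  shows "rsmult (tensor_power A B (Suc n)) (pure_tensor A B (Suc n) (xs @ [x])) a =
    pure_tensor A B (Suc n) (xs @ [x \<otimes> a])"
proof -
  have "butlast xs @ [last xs \<otimes> a] \<in> tuples A (Suc n)" if "xs \<in> tuples A (Suc n)" for xs
    using that assms(1) by (cases xs rule: rev_cases) (auto simp: tuples_append)
  from tensor_induced_pure(2)[OF this rsmult_balanced, of "xs @ [x]"] show ?thesis
    using assms by (simp add: tensor_power_def tuples_def)
qed

lemma lsmult_hom:
  assumes "a \<in> carrier A"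
  shows "lsmult (tensor_power A B (Suc n)) a \<in> hom (tensor_group A B (Suc n)) (tensor_group A B (Suc n))"
proof -
  have "(a \<otimes> hd xs) # tl xs \<in> tuples A (Suc n)" if "xs \<in> tuples A (Suc n)" for xs
    using that assms(1) by (cases xs) auto
  from tensor_induced_pure(1)[OF this lsmult_balanced] show ?thesis
    using assms by (simp add: tensor_power_def)
qed

lemma rsmult_hom:
  assumes "a \<in> carrier A"
  shows "(\<lambda>X. rsmult (tensor_power A B (Suc n)) X a) \<in> hom (tensor_group A B (Suc n)) (tensor_group A B (Suc n))"
proof -
  have "butlast xs @ [last xs \<otimes> a] \<in> tuples A (Suc n)" if "xs \<in> tuples A (Suc n)" for xs
    using that assms(1) by (cases xs rule: rev_cases) (auto simp: tuples_append)
  from tensor_induced_pure(1)[OF this rsmult_balanced] show ?thesis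
    using assms by (simp add: tensor_power_def)
qed

lemma tuples_Suc_cases:
  assumes "xs \<in> tuples A (Suc n)"
  obtains x ys where "xs = x # ys" "x \<in> carrier A" "ys \<in> tuples A n"
  using assms by (cases xs) auto

lemma tuples_Suc_rev_cases:
  assumes "xs \<in> tuples A (Suc n)"
  obtains x ys where "xs = ys @ [x]" "x \<in> carrier A" "ys \<in> tuples A n"
  using assms by (cases xs rule: rev_cases) (auto simp: tuples_append tuples_def)

lemma tensor_power_bimodule: "bimodule A A (tensor_power A B (Suc n))"
proof -
  let ?T = "tensor_group A B (Suc n)" and ?C = "tensor_power A B (Suc n)" and ?p = "pure_tensor A B (Suc n)"
  interpret T: comm_group ?T by (rule tensor_group_comm_group)
  have ab: "abelian_group ?C"
  proof (rule abelian_groupI)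
    fix X assume "X \<in> carrier ?C"
    then show "\<exists>Y\<in>carrier ?C. Y \<oplus>\<^bsub>?C\<^esub> X = \<zero>\<^bsub>?C\<^esub>"
      using T.l_inv[of X] T.inv_closed[of X] by auto
  qed (simp_all add: T.m_ac)
  note eq = tensor_group_hom_eq[OF T.is_group, where n = "Suc n"]
  note comp = hom_compose[of _ ?T ?T _ ?T, unfolded comp_def]
  note mult = hom_pointwise_mult[OF T.comm_group_axioms]
  have id: "(\<lambda>X. X) \<in> hom ?T ?T" by (simp add: hom_def)
  show ?thesis
  proof (intro bimodule.intro bimodule_axioms.intro A.ring_axioms ab; unfold tensor_power_sel)
    fix r X assume "r \<in> carrier A" "X \<in> carrier ?T"
    then show "lsmult ?C r X \<in> carrier ?T" by (rule hom_in_carrier[OF lsmult_hom])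
  next
    fix r X assume "X \<in> carrier ?T" "r \<in> carrier A"
    then show "rsmult ?C X r \<in> carrier ?T" by (intro hom_in_carrier[OF rsmult_hom])
  next
    fix r r' X assume r: "r \<in> carrier A" "r' \<in> carrier A" and X: "X \<in> carrier ?T"
    show "lsmult ?C (r \<oplus> r') X = lsmult ?C r X \<otimes>\<^bsub>?T\<^esub> lsmult ?C r' X"
    proof (rule eq[OF lsmult_hom mult[OF lsmult_hom lsmult_hom] _ X])
      fix xs assume "xs \<in> tuples A (Suc n)"
      then show "lsmult ?C (r \<oplus> r') (?p xs) = lsmult ?C r (?p xs) \<otimes>\<^bsub>?T\<^esub> lsmult ?C r' (?p xs)"
        using r pure_tensor_add[of "[]" "r \<otimes> hd xs" "tl xs" "Suc n" "r' \<otimes> hd xs"]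
        by (elim tuples_Suc_cases) (simp add: lsmult_pure_tensor A.l_distr)
    qed (use r in auto)
  next
    fix r X Y assume "r \<in> carrier A" "X \<in> carrier ?T" "Y \<in> carrier ?T"
    then show "lsmult ?C r (X \<otimes>\<^bsub>?T\<^esub> Y) = lsmult ?C r X \<otimes>\<^bsub>?T\<^esub> lsmult ?C r Y"
      by (intro hom_mult[OF lsmult_hom])
  next
    fix r X Y assume "X \<in> carrier ?T" "Y \<in> carrier ?T" "r \<in> carrier A"
    then show "rsmult ?C (X \<otimes>\<^bsub>?T\<^esub> Y) r = rsmult ?C X r \<otimes>\<^bsub>?T\<^esub> rsmult ?C Y r"
      by (intro hom_mult[OF rsmult_hom])
  next
    fix r r' X assume X: "X \<in> carrier ?T" and r: "r \<in> carrier A" "r' \<in> carrier A"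
    show "rsmult ?C X (r \<oplus> r') = rsmult ?C X r \<otimes>\<^bsub>?T\<^esub> rsmult ?C X r'"
    proof (rule eq[OF rsmult_hom mult[OF rsmult_hom rsmult_hom] _ X])
      fix xs assume "xs \<in> tuples A (Suc n)"
      then show "rsmult ?C (?p xs) (r \<oplus> r') = rsmult ?C (?p xs) r \<otimes>\<^bsub>?T\<^esub> rsmult ?C (?p xs) r'"
        using r pure_tensor_add[of "butlast xs" "last xs \<otimes> r" "[]" "Suc n" "last xs \<otimes> r'"]
        by (elim tuples_Suc_rev_cases) (simp add: rsmult_pure_tensor A.r_distr tuples_append, simp add: tuples_def)
    qed (use r in auto)
  next
    fix r r' X assume r: "r \<in> carrier A" "r' \<in> carrier A" and X: "X \<in> carrier ?T"
    show "lsmult ?C (r \<otimes> r') X = lsmult ?C r (lsmult ?C r' X)"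
    proof (rule eq[OF lsmult_hom comp[OF lsmult_hom lsmult_hom] _ X])
      fix xs assume "xs \<in> tuples A (Suc n)"
      then show "lsmult ?C (r \<otimes> r') (?p xs) = lsmult ?C r (lsmult ?C r' (?p xs))"
        using r by (elim tuples_Suc_cases) (simp add: lsmult_pure_tensor A.m_assoc)
    qed (use r in auto)
  next
    fix r r' X assume X: "X \<in> carrier ?T" and r: "r \<in> carrier A" "r' \<in> carrier A"
    show "rsmult ?C X (r \<otimes> r') = rsmult ?C (rsmult ?C X r) r'"
    proof (rule eq[OF rsmult_hom comp[OF rsmult_hom rsmult_hom] _ X])
      fix xs assume "xs \<in> tuples A (Suc n)"
      then show "rsmult ?C (?p xs) (r \<otimes> r') = rsmult ?C (rsmult ?C (?p xs) r) r'"
        using r by (elim tuples_Suc_rev_cases) (simp add: rsmult_pure_tensor A.m_assoc)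
    qed (use r in auto)
  next
    fix X assume X: "X \<in> carrier ?T"
    show "lsmult ?C \<one> X = X"
    proof (rule eq[OF lsmult_hom id _ X])
      fix xs assume "xs \<in> tuples A (Suc n)"
      then show "lsmult ?C \<one> (?p xs) = ?p xs"
        by (elim tuples_Suc_cases) (simp add: lsmult_pure_tensor)
    qed auto
  next
    fix X assume X: "X \<in> carrier ?T"
    show "rsmult ?C X \<one> = X"
    proof (rule eq[OF rsmult_hom id _ X])
      fix xs assume "xs \<in> tuples A (Suc n)"
      then show "rsmult ?C (?p xs) \<one> = ?p xs"
        by (elim tuples_Suc_rev_cases) (simp add: rsmult_pure_tensor)
    qed auto
  next
    fix r X s assume r: "r \<in> carrier A" and X: "X \<in> carrier ?T" and s: "s \<in> carrier A"
    show "rsmult ?C (lsmult ?C r X) s = lsmult ?C r (rsmult ?C X s)"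
    proof (rule eq[OF comp[OF lsmult_hom rsmult_hom] comp[OF rsmult_hom lsmult_hom] _ X])
      fix xs assume "xs \<in> tuples A (Suc n)"
      then obtain x ys where xs: "xs = x # ys" "x \<in> carrier A" "ys \<in> tuples A n"
        by (elim tuples_Suc_cases)
      show "rsmult ?C (lsmult ?C r (?p xs)) s = lsmult ?C r (rsmult ?C (?p xs) s)"
      proof (cases n)
        case 0
        then show ?thesis
          using xs r s lsmult_pure_tensor[of _ _ "[]" 0] rsmult_pure_tensor[of _ _ "[]" 0]
          by (simp add: tuples_def A.m_assoc)
      next
        case (Suc m)
        then obtain z zs where zs: "ys = zs @ [z]" "z \<in> carrier A" "zs \<in> tuples A m"
          using xs(3) by (auto elim: tuples_Suc_rev_cases)
        have "ys' @ [z'] \<in> tuples A (Suc k)" if "ys' \<in> tuples A k" "z' \<in> carrier A" for ys' z' k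
          using that by (auto simp: tuples_def)
        then show ?thesis
          using xs(2) zs r s Suc rsmult_pure_tensor[of _ _ "_ # zs" n]
          by (simp add: xs(1) lsmult_pure_tensor)
      qed
    qed (use r s in auto)
  qed
qed

lemma tensor_power_bimodule_restrict:
  assumes "subring P A" "subring Q A"
  shows "bimodule (A\<lparr>carrier := P\<rparr>) (A\<lparr>carrier := Q\<rparr>) (tensor_power A B (Suc n))"
  by (rule bimodule_restrict[OF tensor_power_bimodule assms])

end

section \<open>Induction of bimodules\<close>

text \<open>\<open>E\<close> is \<open>A \<otimes>\<^sub>B M\<close> with \<open>\<tau> x m\<close> for \<open>x \<otimes> m\<close>, described by its universal property rather than by a
  construction. There are two reasons. The functor \<open>A \<otimes>\<^sub>B -\<close> has to turn \<open>C\<^sub>n(A, B)\<close> into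
  \<open>C\<^sub>n\<^sub>+\<^sub>1(A, B)\<close> itself and not into an isomorphic iterated tensor product; and it has to apply to
  \<open>C\<^sub>0(A, B) = B\<close> as well, whose elements have a different type.

  Since a locale assumption cannot quantify over types, the universal property is stated for targets
  that have the type of \<open>E\<close>; all the induced bimodules below live on one type, so this is enough.\<close>

locale induced_bimodule =
  fixes A :: "('a, 'r) ring_scheme" and B :: "'a set" and S :: "('b, 's) ring_scheme"
    and M :: "('a, 'b, 'm, 'z) bimodule_scheme" and E :: "('a, 'b, 'e) bimodule"
    and \<tau> :: "'a \<Rightarrow> 'm \<Rightarrow> 'e"
  assumes base: "bimodule (A\<lparr>carrier := B\<rparr>) S M"
    and ext: "bimodule A S E"
    and base_sub: "B \<subseteq> carrier A"
    and tensor_closed: "\<lbrakk>x \<in> carrier A; m \<in> carrier M\<rbrakk> \<Longrightarrow> \<tau> x m \<in> carrier E"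
    and tensor_add_left: "\<lbrakk>x \<in> carrier A; y \<in> carrier A; m \<in> carrier M\<rbrakk> \<Longrightarrow>
      \<tau> (x \<oplus>\<^bsub>A\<^esub> y) m = \<tau> x m \<oplus>\<^bsub>E\<^esub> \<tau> y m"
    and tensor_add_right: "\<lbrakk>x \<in> carrier A; m \<in> carrier M; m' \<in> carrier M\<rbrakk> \<Longrightarrow>
      \<tau> x (m \<oplus>\<^bsub>M\<^esub> m') = \<tau> x m \<oplus>\<^bsub>E\<^esub> \<tau> x m'"
    and tensor_balance: "\<lbrakk>x \<in> carrier A; b \<in> B; m \<in> carrier M\<rbrakk> \<Longrightarrow>
      \<tau> (x \<otimes>\<^bsub>A\<^esub> b) m = \<tau> x (lsmult M b m)"
    and tensor_lsmult: "\<lbrakk>a \<in> carrier A; x \<in> carrier A; m \<in> carrier M\<rbrakk> \<Longrightarrow>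
      lsmult E a (\<tau> x m) = \<tau> (a \<otimes>\<^bsub>A\<^esub> x) m"
    and tensor_rsmult: "\<lbrakk>x \<in> carrier A; m \<in> carrier M; s \<in> carrier S\<rbrakk> \<Longrightarrow>
      rsmult E (\<tau> x m) s = \<tau> x (rsmult M m s)"
    and universal: "\<And>(G :: ('a, 'b, 'e) bimodule) \<beta>. \<lbrakk>abelian_group G;
      \<And>x m. \<lbrakk>x \<in> carrier A; m \<in> carrier M\<rbrakk> \<Longrightarrow> \<beta> x m \<in> carrier G;
      \<And>x y m. \<lbrakk>x \<in> carrier A; y \<in> carrier A; m \<in> carrier M\<rbrakk> \<Longrightarrow>
        \<beta> (x \<oplus>\<^bsub>A\<^esub> y) m = \<beta> x m \<oplus>\<^bsub>G\<^esub> \<beta> y m;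
      \<And>x m m'. \<lbrakk>x \<in> carrier A; m \<in> carrier M; m' \<in> carrier M\<rbrakk> \<Longrightarrow>
        \<beta> x (m \<oplus>\<^bsub>M\<^esub> m') = \<beta> x m \<oplus>\<^bsub>G\<^esub> \<beta> x m';
      \<And>x b m. \<lbrakk>x \<in> carrier A; b \<in> B; m \<in> carrier M\<rbrakk> \<Longrightarrow>
        \<beta> (x \<otimes>\<^bsub>A\<^esub> b) m = \<beta> x (lsmult M b m)\<rbrakk> \<Longrightarrow>
      \<exists>h \<in> hom (add_monoid E) (add_monoid G). \<forall>x \<in> carrier A. \<forall>m \<in> carrier M. h (\<tau> x m) = \<beta> x m"
    and unique: "\<And>(G :: ('a, 'b, 'e) bimodule) h k. \<lbrakk>abelian_group G;
      h \<in> hom (add_monoid E) (add_monoid G); k \<in> hom (add_monoid E) (add_monoid G);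
      \<And>x m. \<lbrakk>x \<in> carrier A; m \<in> carrier M\<rbrakk> \<Longrightarrow> h (\<tau> x m) = k (\<tau> x m)\<rbrakk> \<Longrightarrow>
      \<forall>e \<in> carrier E. h e = k e"

text \<open>The functor on morphisms: \<open>f\<close> induces \<open>x \<otimes> m \<mapsto> x \<otimes> f m\<close>, which is balanced because \<open>f\<close> is
  \<open>B\<close>-linear. The induced map is left \<open>A\<close>-linear since \<open>A\<close> acts on the first factor alone, which the
  induced map leaves untouched.\<close>

lemma induced_map:
  fixes E F :: "('a, 'b, 'e) bimodule"
  assumes M: "induced_bimodule A B S M E \<tau>" and N: "induced_bimodule A B S N F \<sigma>"
    and f: "f \<in> bimodule_hom (A\<lparr>carrier := B\<rparr>) S M N"
  shows "\<exists>h \<in> bimodule_hom A S E F. \<forall>x \<in> carrier A. \<forall>m \<in> carrier M. h (\<tau> x m) = \<sigma> x (f m)"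
proof -
  interpret M: induced_bimodule A B S M E \<tau> by (rule M)
  interpret N: induced_bimodule A B S N F \<sigma> by (rule N)
  interpret E: bimodule A S E by (rule M.ext)
  interpret F: bimodule A S F by (rule N.ext)
  interpret M0: bimodule "A\<lparr>carrier := B\<rparr>" S M by (rule M.base)
  note fD = bimodule_homD[OF f]
  have "\<exists>h \<in> hom (add_monoid E) (add_monoid F). \<forall>x \<in> carrier A. \<forall>m \<in> carrier M. h (\<tau> x m) = \<sigma> x (f m)"
    by (rule M.universal[OF F.abelian_group_axioms])
      (simp_all add: fD N.tensor_closed N.tensor_add_left N.tensor_add_right N.tensor_balance)
  then obtain h where h: "h \<in> hom (add_monoid E) (add_monoid F)"
    and h\<tau>: "\<And>x m. \<lbrakk>x \<in> carrier A; m \<in> carrier M\<rbrakk> \<Longrightarrow> h (\<tau> x m) = \<sigma> x (f m)" by blast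
  have hE: "h e \<in> carrier F" if "e \<in> carrier E" for e using h that by (auto simp: hom_def)
  have hadd: "h (e \<oplus>\<^bsub>E\<^esub> e') = h e \<oplus>\<^bsub>F\<^esub> h e'" if "e \<in> carrier E" "e' \<in> carrier E" for e e'
    using h that by (auto simp: hom_def)
  have "h \<in> bimodule_hom A S E F"
  proof (rule bimodule_homI)
    fix r e assume r: "r \<in> carrier A" and e: "e \<in> carrier E"
    show "h (lsmult E r e) = lsmult F r (h e)"
    proof (rule bspec[OF M.unique[OF F.abelian_group_axioms] e])
      show "(\<lambda>e. h (lsmult E r e)) \<in> hom (add_monoid E) (add_monoid F)"
        using r by (auto simp: hom_def hE hadd E.lsmult_closed E.lsmult_r_distr)
      show "(\<lambda>e. lsmult F r (h e)) \<in> hom (add_monoid E) (add_monoid F)"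
        using r by (auto simp: hom_def hE hadd F.lsmult_closed F.lsmult_r_distr)
    qed (simp add: r h\<tau> M.tensor_lsmult N.tensor_lsmult fD)
  next
    fix e s assume e: "e \<in> carrier E" and s: "s \<in> carrier S"
    show "h (rsmult E e s) = rsmult F (h e) s"
    proof (rule bspec[OF M.unique[OF F.abelian_group_axioms] e])
      show "(\<lambda>e. h (rsmult E e s)) \<in> hom (add_monoid E) (add_monoid F)"
        using s by (auto simp: hom_def hE hadd E.rsmult_closed E.rsmult_l_distr)
      show "(\<lambda>e. rsmult F (h e) s) \<in> hom (add_monoid E) (add_monoid F)"
        using s by (auto simp: hom_def hE hadd F.rsmult_closed F.rsmult_l_distr)
    qed (simp add: s h\<tau> M.tensor_rsmult N.tensor_rsmult fD M0.rsmult_closed)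
  qed (simp_all add: hE hadd)
  then show ?thesis using h\<tau> by blast
qed

text \<open>The functor is additive, so it carries a factorisation \<open>n = \<Sum>\<^sub>i f\<^sub>i (g\<^sub>i n)\<close> to one for the induced
  bimodules. What was a relation of \<open>B\<close>-\<open>S\<close>-bimodules becomes one of \<open>A\<close>-\<open>S\<close>-bimodules: this is the
  step that improves a depth condition to an H-depth condition.\<close>

theorem induced_summand_of_power:
  fixes E F :: "('a, 'b, 'e) bimodule"
  assumes M: "induced_bimodule A B S M E \<tau>" and N: "induced_bimodule A B S N F \<sigma>"
    and "summand_of_power (A\<lparr>carrier := B\<rparr>) S N M q"
  shows "summand_of_power A S F E q"
proof -
  interpret M: induced_bimodule A B S M E \<tau> by (rule M)
  interpret N: induced_bimodule A B S N F \<sigma> by (rule N)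
  interpret F: bimodule A S F by (rule N.ext)
  interpret N0: bimodule "A\<lparr>carrier := B\<rparr>" S N by (rule N.base)
  obtain f g where fg: "\<forall>i<q. f i \<in> bimodule_hom (A\<lparr>carrier := B\<rparr>) S M N \<and>
        g i \<in> bimodule_hom (A\<lparr>carrier := B\<rparr>) S N M"
    and id: "\<forall>n \<in> carrier N. (\<Oplus>\<^bsub>N\<^esub>i\<in>{..<q}. f i (g i n)) = n"
    using assms(3) unfolding summand_of_power_iff[OF M.base N.base] by (elim exE conjE)
  have "\<exists>h. i < q \<longrightarrow> h \<in> bimodule_hom A S E F \<and>
      (\<forall>x \<in> carrier A. \<forall>m \<in> carrier M. h (\<tau> x m) = \<sigma> x (f i m))" for i
    using induced_map[OF M N] fg by blast
  then obtain f' where f': "\<And>i. i < q \<Longrightarrow> f' i \<in> bimodule_hom A S E F"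
    and f'\<tau>: "\<And>i x m. \<lbrakk>i < q; x \<in> carrier A; m \<in> carrier M\<rbrakk> \<Longrightarrow> f' i (\<tau> x m) = \<sigma> x (f i m)"
    by metis
  have "\<exists>h. i < q \<longrightarrow> h \<in> bimodule_hom A S F E \<and>
      (\<forall>x \<in> carrier A. \<forall>n \<in> carrier N. h (\<sigma> x n) = \<tau> x (g i n))" for i
    using induced_map[OF N M] fg by blast
  then obtain g' where g': "\<And>i. i < q \<Longrightarrow> g' i \<in> bimodule_hom A S F E"
    and g'\<sigma>: "\<And>i x n. \<lbrakk>i < q; x \<in> carrier A; n \<in> carrier N\<rbrakk> \<Longrightarrow> g' i (\<sigma> x n) = \<tau> x (g i n)"
    by metis
  have gN: "g i n \<in> carrier M" if "i < q" "n \<in> carrier N" for i n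
    using fg that bimodule_homD(2) by metis
  have fM: "f i m \<in> carrier N" if "i < q" "m \<in> carrier M" for i m
    using fg that bimodule_homD(2) by metis
  have c: "f' i (g' i e) \<in> carrier F" if "i < q" "e \<in> carrier F" for i e
    using bimodule_homD(2)[OF f'] bimodule_homD(2)[OF g'] that by blast
  have "(\<Oplus>\<^bsub>F\<^esub>i\<in>{..<q}. f' i (g' i e)) = e" if e: "e \<in> carrier F" for e
  proof (rule bspec[OF N.unique[OF F.abelian_group_axioms] e])
    have add: "f' i (g' i (e \<oplus>\<^bsub>F\<^esub> e')) = f' i (g' i e) \<oplus>\<^bsub>F\<^esub> f' i (g' i e')"
      if "i < q" "e \<in> carrier F" "e' \<in> carrier F" for i e e'
      using bimodule_homD(3)[OF bimodule_hom_compose[OF g' f']] that by blast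
    show "(\<lambda>e. \<Oplus>\<^bsub>F\<^esub>i\<in>{..<q}. f' i (g' i e)) \<in> hom (add_monoid F) (add_monoid F)"
    proof (rule homI)
      fix e e' assume e: "e \<in> carrier (add_monoid F)" "e' \<in> carrier (add_monoid F)"
      have "(\<Oplus>\<^bsub>F\<^esub>i\<in>{..<q}. f' i (g' i (e \<oplus>\<^bsub>F\<^esub> e'))) = (\<Oplus>\<^bsub>F\<^esub>i\<in>{..<q}. f' i (g' i e) \<oplus>\<^bsub>F\<^esub> f' i (g' i e'))"
        by (rule F.finsum_cong') (use e in \<open>auto simp: add c\<close>)
      then show "(\<Oplus>\<^bsub>F\<^esub>i\<in>{..<q}. f' i (g' i (e \<otimes>\<^bsub>add_monoid F\<^esub> e'))) =
          (\<Oplus>\<^bsub>F\<^esub>i\<in>{..<q}. f' i (g' i e)) \<otimes>\<^bsub>add_monoid F\<^esub> (\<Oplus>\<^bsub>F\<^esub>i\<in>{..<q}. f' i (g' i e'))"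
        using e by (simp add: F.finsum_addf Pi_def c)
    qed (auto intro!: F.finsum_closed simp: c)
  next
    show "(\<lambda>e. e) \<in> hom (add_monoid F) (add_monoid F)" by (simp add: hom_def)
  next
    fix x n assume x: "x \<in> carrier A" and n: "n \<in> carrier N"
    have "(\<Oplus>\<^bsub>F\<^esub>i\<in>{..<q}. f' i (g' i (\<sigma> x n))) = (\<Oplus>\<^bsub>F\<^esub>i\<in>{..<q}. \<sigma> x (f i (g i n)))"
      by (rule F.finsum_cong') (use x n in \<open>auto simp: f'\<tau> g'\<sigma> gN fM N.tensor_closed\<close>)
    also have "\<dots> = \<sigma> x (\<Oplus>\<^bsub>N\<^esub>i\<in>{..<q}. f i (g i n))"
      by (rule add_hom_finsum[symmetric, OF N0.abelian_group_axioms F.abelian_group_axioms])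
        (use x n in \<open>auto simp: hom_def N.tensor_closed N.tensor_add_right gN fM\<close>)
    also have "\<dots> = \<sigma> x n" using id n by simp
    finally show "(\<Oplus>\<^bsub>F\<^esub>i\<in>{..<q}. f' i (g' i (\<sigma> x n))) = \<sigma> x n" .
  qed
  then show ?thesis
    unfolding summand_of_power_iff[OF M.ext N.ext] using f' g'
    by (intro exI[where x = f'] exI[where x = g']) simp
qed

text \<open>For an \<open>A\<close>-\<open>S\<close>-bimodule \<open>M\<close> the multiplication \<open>A \<otimes>\<^sub>B M \<rightarrow> M\<close> is split by \<open>m \<mapsto> 1 \<otimes> m\<close>, and this section
  is linear over \<open>B\<close> on the left, though in general not over \<open>A\<close>. For \<open>M = C\<^sub>n(A, B)\<close> this is the
  half of the H-equivalence in left depth \<open>2n\<close> that holds for every subring.\<close>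

lemma induced_counit_splits:
  fixes M E :: "('a, 'b, 'e) bimodule"
  assumes ind: "induced_bimodule A B S M E \<tau>" and M: "bimodule A S M" and B: "subring B A"
  shows "summand_of_power (A\<lparr>carrier := B\<rparr>) S M E 1"
proof -
  interpret I: induced_bimodule A B S M E \<tau> by (rule ind)
  interpret M: bimodule A S M by (rule M)
  interpret E: bimodule A S E by (rule I.ext)
  have BA: "b \<in> carrier A" if "b \<in> B" for b using I.base_sub that by blast
  have "bimodule (A\<lparr>carrier := B\<rparr>) S E"
    using bimodule_restrict[OF I.ext B ring.carrier_is_subring[OF bimodule.axioms(2)[OF M]]] by simp
  note iff = summand_of_power_iff[OF this I.base]
  have "\<exists>h \<in> hom (add_monoid E) (add_monoid M). \<forall>x \<in> carrier A. \<forall>m \<in> carrier M. h (\<tau> x m) = lsmult M x m"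
    by (rule I.universal[OF M.abelian_group_axioms])
      (simp_all add: M.lsmult_closed M.lsmult_l_distr M.lsmult_r_distr M.lsmult_assoc BA)
  then obtain h where h: "h \<in> hom (add_monoid E) (add_monoid M)"
    and h\<tau>: "\<And>x m. \<lbrakk>x \<in> carrier A; m \<in> carrier M\<rbrakk> \<Longrightarrow> h (\<tau> x m) = lsmult M x m" by blast
  have hE: "h e \<in> carrier M" if "e \<in> carrier E" for e using h that by (auto simp: hom_def)
  have hadd: "h (e \<oplus>\<^bsub>E\<^esub> e') = h e \<oplus>\<^bsub>M\<^esub> h e'" if "e \<in> carrier E" "e' \<in> carrier E" for e e'
    using h that by (auto simp: hom_def)
  have "h \<in> bimodule_hom (A\<lparr>carrier := B\<rparr>) S E M"
  proof (rule bimodule_homI)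
    fix r e assume "r \<in> carrier (A\<lparr>carrier := B\<rparr>)" and e: "e \<in> carrier E"
    then have r: "r \<in> carrier A" by (simp add: BA)
    show "h (lsmult E r e) = lsmult M r (h e)"
    proof (rule bspec[OF I.unique[OF M.abelian_group_axioms] e])
      show "(\<lambda>e. h (lsmult E r e)) \<in> hom (add_monoid E) (add_monoid M)"
        using r by (auto simp: hom_def hE hadd E.lsmult_closed E.lsmult_r_distr)
      show "(\<lambda>e. lsmult M r (h e)) \<in> hom (add_monoid E) (add_monoid M)"
        using r by (auto simp: hom_def hE hadd M.lsmult_closed M.lsmult_r_distr)
    qed (simp add: r h\<tau> I.tensor_lsmult M.lsmult_assoc)
  next
    fix e s assume e: "e \<in> carrier E" and s: "s \<in> carrier S"
    show "h (rsmult E e s) = rsmult M (h e) s"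
    proof (rule bspec[OF I.unique[OF M.abelian_group_axioms] e])
      show "(\<lambda>e. h (rsmult E e s)) \<in> hom (add_monoid E) (add_monoid M)"
        using s by (auto simp: hom_def hE hadd E.rsmult_closed E.rsmult_l_distr)
      show "(\<lambda>e. rsmult M (h e) s) \<in> hom (add_monoid E) (add_monoid M)"
        using s by (auto simp: hom_def hE hadd M.rsmult_closed M.rsmult_l_distr)
    qed (simp add: s h\<tau> I.tensor_rsmult M.rsmult_closed M.smult_commute)
  qed (simp_all add: hE hadd)
  moreover have "\<tau> \<one>\<^bsub>A\<^esub> \<in> bimodule_hom (A\<lparr>carrier := B\<rparr>) S M E"
  proof (rule bimodule_homI)
    fix r m assume "r \<in> carrier (A\<lparr>carrier := B\<rparr>)" and m: "m \<in> carrier M"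
    then have r: "r \<in> B" by simp
    show "\<tau> \<one>\<^bsub>A\<^esub> (lsmult M r m) = lsmult E r (\<tau> \<one>\<^bsub>A\<^esub> m)"
      using I.tensor_balance[of "\<one>\<^bsub>A\<^esub>" r m] I.tensor_lsmult[of r "\<one>\<^bsub>A\<^esub>" m] r m by (simp add: BA)
  qed (simp_all add: I.tensor_closed I.tensor_add_right I.tensor_rsmult)
  moreover have "(\<Oplus>\<^bsub>M\<^esub>i\<in>{..<1::nat}. h (\<tau> \<one>\<^bsub>A\<^esub> m)) = m" if "m \<in> carrier M" for m
    using that by (simp add: h\<tau> M.lsmult_one M.finsum_insert lessThan_Suc)
  ultimately show ?thesis
    unfolding iff by (intro exI[where x = "\<lambda>_. h"] exI[where x = "\<lambda>_. \<tau> \<one>\<^bsub>A\<^esub>"]) simp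
qed

context ring_extension
begin

lemma regular_bimodule_bimodule:
  "bimodule (A\<lparr>carrier := B\<rparr>) (A\<lparr>carrier := B\<rparr>) (regular_bimodule (A\<lparr>carrier := B\<rparr>))"
proof -
  interpret R: ring "A\<lparr>carrier := B\<rparr>" by (rule A.subring_is_ring[OF subring_B])
  have "abelian_group (regular_bimodule (A\<lparr>carrier := B\<rparr>))"
  proof (rule abelian_groupI)
    fix x assume "x \<in> carrier (regular_bimodule (A\<lparr>carrier := B\<rparr>))"
    then show "\<exists>y\<in>carrier (regular_bimodule (A\<lparr>carrier := B\<rparr>)).
        y \<oplus>\<^bsub>regular_bimodule (A\<lparr>carrier := B\<rparr>)\<^esub> x = \<zero>\<^bsub>regular_bimodule (A\<lparr>carrier := B\<rparr>)\<^esub>"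
      using R.l_neg[of x] R.a_inv_closed[of x] by (auto simp: regular_bimodule_def)
  qed (use R.add.m_closed R.zero_closed R.a_assoc R.a_comm R.l_zero in \<open>auto simp: regular_bimodule_def\<close>)
  then show ?thesis
    using R.m_closed R.l_distr R.r_distr R.m_assoc R.l_one R.r_one
    by (intro bimodule.intro bimodule_axioms.intro R.ring_axioms) (auto simp: regular_bimodule_def)
qed

text \<open>\<open>A \<otimes>\<^sub>B C\<^sub>n(A, B) = C\<^sub>n\<^sub>+\<^sub>1(A, B)\<close> for \<open>n \<ge> 1\<close>: tensoring with \<open>x\<close> puts \<open>x\<close> in front of a tuple. That
  \<open>n\<close> is positive matters twice, as the balancing relation between \<open>x\<close> and the rest, and the right
  multiplication by \<open>S\<close>, both act on a slot of the second factor.\<close>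

lemma tensor_power_induced:
  assumes Q: "subring Q A"
  shows "\<exists>\<tau>. induced_bimodule A B (A\<lparr>carrier := Q\<rparr>) (tensor_power A B (Suc n)) (tensor_power A B (Suc (Suc n))) \<tau>"
proof -
  let ?T = "\<lambda>n. tensor_group A B n" and ?C = "\<lambda>n. tensor_power A B n" and ?p = "\<lambda>n. pure_tensor A B n"
  interpret T2: comm_group "?T (Suc (Suc n))" by (rule tensor_group_comm_group)
  note QA = subringE(1)[OF Q]
  have bal: "balanced_map A B (Suc n) (?T (Suc (Suc n))) (\<lambda>xs. ?p (Suc (Suc n)) (x # xs))"
    if x: "x \<in> carrier A" for x
  proof (rule balanced_mapI)
    fix xs y z ys assume "xs @ y # ys \<in> tuples A (Suc n)" "z \<in> carrier A"
    then show "?p (Suc (Suc n)) (x # xs @ (y \<oplus> z) # ys) =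
        ?p (Suc (Suc n)) (x # xs @ y # ys) \<otimes>\<^bsub>?T (Suc (Suc n))\<^esub> ?p (Suc (Suc n)) (x # xs @ z # ys)"
      using x pure_tensor_add[of "x # xs" y ys "Suc (Suc n)" z] by simp
  next
    fix xs y b z ys assume "xs @ y # z # ys \<in> tuples A (Suc n)" "b \<in> B"
    then show "?p (Suc (Suc n)) (x # xs @ (y \<otimes> b) # z # ys) = ?p (Suc (Suc n)) (x # xs @ y # (b \<otimes> z) # ys)"
      using x pure_tensor_balance[of "x # xs" y z ys "Suc (Suc n)" b] by simp
  qed (use x in simp)
  have "\<exists>h. x \<in> carrier A \<longrightarrow> h \<in> hom (?T (Suc n)) (?T (Suc (Suc n))) \<and>
      (\<forall>xs \<in> tuples A (Suc n). h (?p (Suc n) xs) = ?p (Suc (Suc n)) (x # xs))" for x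
    using tensor_group_universal[OF T2.comm_group_axioms bal] by blast
  then obtain \<tau> where \<tau>: "\<And>x. x \<in> carrier A \<Longrightarrow> \<tau> x \<in> hom (?T (Suc n)) (?T (Suc (Suc n)))"
    and \<tau>p: "\<And>x xs. \<lbrakk>x \<in> carrier A; xs \<in> tuples A (Suc n)\<rbrakk> \<Longrightarrow> \<tau> x (?p (Suc n) xs) = ?p (Suc (Suc n)) (x # xs)"
    by metis
  note eq = tensor_group_hom_eq[OF T2.is_group, where n = "Suc n"]
  note comp = hom_compose[unfolded comp_def]
  note mult = hom_pointwise_mult[OF T2.comm_group_axioms]
  have "induced_bimodule A B (A\<lparr>carrier := Q\<rparr>) (?C (Suc n)) (?C (Suc (Suc n))) \<tau>"
  proof (rule induced_bimodule.intro)
    show "bimodule (A\<lparr>carrier := B\<rparr>) (A\<lparr>carrier := Q\<rparr>) (?C (Suc n))"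
      by (rule tensor_power_bimodule_restrict[OF subring_B Q])
    show "bimodule A (A\<lparr>carrier := Q\<rparr>) (?C (Suc (Suc n)))"
      using tensor_power_bimodule_restrict[OF A.carrier_is_subring Q, of "Suc n"] by simp
    show "B \<subseteq> carrier A" using B_carrier by blast
    show "\<tau> x m \<in> carrier (?C (Suc (Suc n)))" if "x \<in> carrier A" "m \<in> carrier (?C (Suc n))" for x m
      using hom_in_carrier[OF \<tau>] that by simp
    show "\<tau> x (m \<oplus>\<^bsub>?C (Suc n)\<^esub> m') = \<tau> x m \<oplus>\<^bsub>?C (Suc (Suc n))\<^esub> \<tau> x m'"
      if "x \<in> carrier A" "m \<in> carrier (?C (Suc n))" "m' \<in> carrier (?C (Suc n))" for x m m'
      using hom_mult[OF \<tau>] that by simp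
  next
    fix x y m assume x: "x \<in> carrier A" and y: "y \<in> carrier A" and "m \<in> carrier (?C (Suc n))"
    then have m: "m \<in> carrier (?T (Suc n))" by simp
    have "\<tau> (x \<oplus> y) m = \<tau> x m \<otimes>\<^bsub>?T (Suc (Suc n))\<^esub> \<tau> y m"
    proof (rule eq[OF \<tau> mult[OF \<tau> \<tau>] _ m])
      fix xs assume "xs \<in> tuples A (Suc n)"
      then show "\<tau> (x \<oplus> y) (?p (Suc n) xs) = \<tau> x (?p (Suc n) xs) \<otimes>\<^bsub>?T (Suc (Suc n))\<^esub> \<tau> y (?p (Suc n) xs)"
        using x y pure_tensor_add[of "[]" x xs "Suc (Suc n)" y] by (simp add: \<tau>p)
    qed (use x y in auto)
    then show "\<tau> (x \<oplus> y) m = \<tau> x m \<oplus>\<^bsub>?C (Suc (Suc n))\<^esub> \<tau> y m" by simp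
  next
    fix x b m assume x: "x \<in> carrier A" and b: "b \<in> B" and "m \<in> carrier (?C (Suc n))"
    then have m: "m \<in> carrier (?T (Suc n))" and bA: "b \<in> carrier A" by (simp_all add: B_carrier)
    show "\<tau> (x \<otimes> b) m = \<tau> x (lsmult (?C (Suc n)) b m)"
    proof (rule eq[OF \<tau> comp[OF lsmult_hom \<tau>] _ m])
      fix xs assume "xs \<in> tuples A (Suc n)"
      then obtain y ys where "xs = y # ys" "y \<in> carrier A" "ys \<in> tuples A n" by (elim tuples_Suc_cases)
      then show "\<tau> (x \<otimes> b) (?p (Suc n) xs) = \<tau> x (lsmult (?C (Suc n)) b (?p (Suc n) xs))"
        using x b bA pure_tensor_balance[of "[]" x y ys "Suc (Suc n)" b] by (simp add: \<tau>p lsmult_pure_tensor)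
    qed (use x bA in auto)
  next
    fix a x m assume a: "a \<in> carrier A" and x: "x \<in> carrier A" and "m \<in> carrier (?C (Suc n))"
    then have m: "m \<in> carrier (?T (Suc n))" by simp
    show "lsmult (?C (Suc (Suc n))) a (\<tau> x m) = \<tau> (a \<otimes> x) m"
      by (rule eq[OF comp[OF \<tau> lsmult_hom] \<tau> _ m]) (use a x in \<open>auto simp: \<tau>p lsmult_pure_tensor\<close>)
  next
    fix x m s assume x: "x \<in> carrier A" and "m \<in> carrier (?C (Suc n))" and "s \<in> carrier (A\<lparr>carrier := Q\<rparr>)"
    then have m: "m \<in> carrier (?T (Suc n))" and s: "s \<in> carrier A" using QA by auto
    show "rsmult (?C (Suc (Suc n))) (\<tau> x m) s = \<tau> x (rsmult (?C (Suc n)) m s)"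
    proof (rule eq[OF comp[OF \<tau> rsmult_hom] comp[OF rsmult_hom \<tau>] _ m])
      fix xs assume "xs \<in> tuples A (Suc n)"
      then obtain y ys where ys: "xs = ys @ [y]" "y \<in> carrier A" "ys \<in> tuples A n" by (elim tuples_Suc_rev_cases)
      have "ys @ [z] \<in> tuples A (Suc n)" if "z \<in> carrier A" for z using ys that by (auto simp: tuples_def)
      then show "rsmult (?C (Suc (Suc n))) (\<tau> x (?p (Suc n) xs)) s = \<tau> x (rsmult (?C (Suc n)) (?p (Suc n) xs) s)"
        using x s ys rsmult_pure_tensor[of s y "x # ys" "Suc n"] by (simp add: \<tau>p rsmult_pure_tensor)
    qed (use x s in auto)
  next
    fix G :: "('a, 'a, ('a list \<Rightarrow>\<^sub>0 int) set) bimodule" and \<beta>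
    assume G: "abelian_group G"
      and closed: "\<And>x m. \<lbrakk>x \<in> carrier A; m \<in> carrier (?C (Suc n))\<rbrakk> \<Longrightarrow> \<beta> x m \<in> carrier G"
      and addl: "\<And>x y m. \<lbrakk>x \<in> carrier A; y \<in> carrier A; m \<in> carrier (?C (Suc n))\<rbrakk> \<Longrightarrow>
        \<beta> (x \<oplus> y) m = \<beta> x m \<oplus>\<^bsub>G\<^esub> \<beta> y m"
      and addr: "\<And>x m m'. \<lbrakk>x \<in> carrier A; m \<in> carrier (?C (Suc n)); m' \<in> carrier (?C (Suc n))\<rbrakk> \<Longrightarrow>
        \<beta> x (m \<oplus>\<^bsub>?C (Suc n)\<^esub> m') = \<beta> x m \<oplus>\<^bsub>G\<^esub> \<beta> x m'"
      and balance: "\<And>x b m. \<lbrakk>x \<in> carrier A; b \<in> B; m \<in> carrier (?C (Suc n))\<rbrakk> \<Longrightarrow>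
        \<beta> (x \<otimes> b) m = \<beta> x (lsmult (?C (Suc n)) b m)"
    interpret G: abelian_group G by (rule G)
    have "balanced_map A B (Suc (Suc n)) (add_monoid G) (\<lambda>xs. \<beta> (hd xs) (?p (Suc n) (tl xs)))"
    proof (rule balanced_mapI)
      fix xs assume "xs \<in> tuples A (Suc (Suc n))"
      then show "\<beta> (hd xs) (?p (Suc n) (tl xs)) \<in> carrier (add_monoid G)"
        by (elim tuples_Suc_cases) (simp add: closed)
    next
      fix xs x y ys assume t: "xs @ x # ys \<in> tuples A (Suc (Suc n))" and y: "y \<in> carrier A"
      show "\<beta> (hd (xs @ (x \<oplus> y) # ys)) (?p (Suc n) (tl (xs @ (x \<oplus> y) # ys))) =
          \<beta> (hd (xs @ x # ys)) (?p (Suc n) (tl (xs @ x # ys))) \<otimes>\<^bsub>add_monoid G\<^esub>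
          \<beta> (hd (xs @ y # ys)) (?p (Suc n) (tl (xs @ y # ys)))"
      proof (cases xs)
        case Nil
        then show ?thesis using t y by (simp add: addl)
      next
        case (Cons z zs)
        then have "zs @ y # ys \<in> tuples A (Suc n)" using t y by (auto simp: tuples_append)
        then show ?thesis
          using t y Cons pure_tensor_add[of zs x ys "Suc n" y] addr[of z "?p (Suc n) (zs @ x # ys)" "?p (Suc n) (zs @ y # ys)"]
          by simp
      qed
    next
      fix xs x b y ys assume t: "xs @ x # y # ys \<in> tuples A (Suc (Suc n))" and b: "b \<in> B"
      show "\<beta> (hd (xs @ (x \<otimes> b) # y # ys)) (?p (Suc n) (tl (xs @ (x \<otimes> b) # y # ys))) =
          \<beta> (hd (xs @ x # (b \<otimes> y) # ys)) (?p (Suc n) (tl (xs @ x # (b \<otimes> y) # ys)))"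
      proof (cases xs)
        case Nil
        then show ?thesis using t b B_carrier[OF b] by (simp add: balance lsmult_pure_tensor)
      next
        case (Cons z zs)
        then show ?thesis using t b pure_tensor_balance[of zs x y ys "Suc n" b] by simp
      qed
    qed
    from tensor_group_universal[OF G.a_comm_group this]
    obtain h where h: "h \<in> hom (?T (Suc (Suc n))) (add_monoid G)"
      and hp: "\<And>xs. xs \<in> tuples A (Suc (Suc n)) \<Longrightarrow> h (?p (Suc (Suc n)) xs) = \<beta> (hd xs) (?p (Suc n) (tl xs))"
      by blast
    have h\<tau>: "h (\<tau> x m) = \<beta> x m" if x: "x \<in> carrier A" and m: "m \<in> carrier (?T (Suc n))" for x m
    proof (rule tensor_group_hom_eq[OF G.a_group comp[OF \<tau>[OF x] h] _ _ m])
      show "\<beta> x \<in> hom (?T (Suc n)) (add_monoid G)"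
        using x closed addr by (auto simp: hom_def)
    qed (use x in \<open>simp add: \<tau>p hp\<close>)
    show "\<exists>h \<in> hom (add_monoid (?C (Suc (Suc n)))) (add_monoid G).
        \<forall>x \<in> carrier A. \<forall>m \<in> carrier (?C (Suc n)). h (\<tau> x m) = \<beta> x m"
    proof (rule bexI[where x = h])
      show "h \<in> hom (add_monoid (?C (Suc (Suc n)))) (add_monoid G)"
        using h unfolding hom_tensor_power .
    qed (simp add: h\<tau>)
  next
    fix G :: "('a, 'a, ('a list \<Rightarrow>\<^sub>0 int) set) bimodule" and h k
    assume G: "abelian_group G"
      and h: "h \<in> hom (add_monoid (?C (Suc (Suc n)))) (add_monoid G)"
      and k: "k \<in> hom (add_monoid (?C (Suc (Suc n)))) (add_monoid G)"
      and hk: "\<And>x m. \<lbrakk>x \<in> carrier A; m \<in> carrier (?C (Suc n))\<rbrakk> \<Longrightarrow> h (\<tau> x m) = k (\<tau> x m)"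
    show "\<forall>e \<in> carrier (?C (Suc (Suc n))). h e = k e"
    proof
      fix e assume "e \<in> carrier (?C (Suc (Suc n)))"
      then have e: "e \<in> carrier (?T (Suc (Suc n)))" by simp
      show "h e = k e"
      proof (rule tensor_group_hom_eq[OF abelian_group.a_group[OF G] h[unfolded hom_tensor_power] k[unfolded hom_tensor_power] _ e])
        fix xs assume "xs \<in> tuples A (Suc (Suc n))"
        then obtain x ys where "xs = x # ys" "x \<in> carrier A" "ys \<in> tuples A (Suc n)"
          by (rule tuples_Suc_cases)
        then show "h (?p (Suc (Suc n)) xs) = k (?p (Suc (Suc n)) xs)"
          using hk[of x "?p (Suc n) ys"] by (simp add: \<tau>p)
      qed
    qed
  qed
  then show ?thesis by (rule exI[where x = \<tau>])
qed

text \<open>\<open>A \<otimes>\<^sub>B B = A\<close>, which is what makes depth \<open>1\<close> accessible to the same argument as the other odd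
  depths.\<close>

lemma regular_bimodule_induced:
  "induced_bimodule A B (A\<lparr>carrier := B\<rparr>) (regular_bimodule (A\<lparr>carrier := B\<rparr>)) (tensor_power A B 1)
    (\<lambda>x b. pure_tensor A B 1 [x \<otimes> b])"
proof (rule induced_bimodule.intro)
  let ?R = "regular_bimodule (A\<lparr>carrier := B\<rparr>)" and ?p = "\<lambda>x. pure_tensor A B 1 [x]"
  have R: "carrier ?R = B" "\<And>x y. x \<oplus>\<^bsub>?R\<^esub> y = x \<oplus> y" "\<And>x y. lsmult ?R x y = x \<otimes> y"
    "\<And>x y. rsmult ?R x y = x \<otimes> y"
    by (simp_all add: regular_bimodule_def)
  note add = pure_tensor_add[of "[]" _ "[]" 1, simplified]
  note B = B_carrier subringE(3,6)[OF subring_B]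
  show "bimodule (A\<lparr>carrier := B\<rparr>) (A\<lparr>carrier := B\<rparr>) ?R" by (rule regular_bimodule_bimodule)
  show "bimodule A (A\<lparr>carrier := B\<rparr>) (tensor_power A B 1)"
    using tensor_power_bimodule_restrict[OF A.carrier_is_subring subring_B, of 0] by simp
  show "B \<subseteq> carrier A" using B_carrier by blast
  show "?p (x \<otimes> m) \<in> carrier (tensor_power A B 1)" if "x \<in> carrier A" "m \<in> carrier ?R" for x m
    using that by (simp add: R B)
  show "?p ((x \<oplus> y) \<otimes> m) = ?p (x \<otimes> m) \<oplus>\<^bsub>tensor_power A B 1\<^esub> ?p (y \<otimes> m)"
    if "x \<in> carrier A" "y \<in> carrier A" "m \<in> carrier ?R" for x y m
    using that by (simp add: R B A.l_distr add)
  show "?p (x \<otimes> (m \<oplus>\<^bsub>?R\<^esub> m')) = ?p (x \<otimes> m) \<oplus>\<^bsub>tensor_power A B 1\<^esub> ?p (x \<otimes> m')"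
    if "x \<in> carrier A" "m \<in> carrier ?R" "m' \<in> carrier ?R" for x m m'
    using that by (simp add: R B A.r_distr add)
  show "?p ((x \<otimes> b) \<otimes> m) = ?p (x \<otimes> lsmult ?R b m)"
    if "x \<in> carrier A" "b \<in> B" "m \<in> carrier ?R" for x b m
    using that by (simp add: R B A.m_assoc)
  show "lsmult (tensor_power A B 1) a (?p (x \<otimes> m)) = ?p ((a \<otimes> x) \<otimes> m)"
    if "a \<in> carrier A" "x \<in> carrier A" "m \<in> carrier ?R" for a x m
    using that lsmult_pure_tensor[of a "x \<otimes> m" "[]" 0] by (simp add: R B A.m_assoc)
  show "rsmult (tensor_power A B 1) (?p (x \<otimes> m)) s = ?p (x \<otimes> rsmult ?R m s)"
    if "x \<in> carrier A" "m \<in> carrier ?R" "s \<in> carrier (A\<lparr>carrier := B\<rparr>)" for x m s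
    using that rsmult_pure_tensor[of s "x \<otimes> m" "[]" 0] by (simp add: R B A.m_assoc)
  have tup1: "\<exists>x. xs = [x] \<and> x \<in> carrier A" if "xs \<in> tuples A (Suc 0)" for xs
    using that by (elim tuples_Suc_cases) (auto simp: tuples_def)
  {
    fix G :: "('a, 'a, ('a list \<Rightarrow>\<^sub>0 int) set) bimodule" and \<beta>
    assume G: "abelian_group G"
      and closed: "\<And>x m. \<lbrakk>x \<in> carrier A; m \<in> carrier ?R\<rbrakk> \<Longrightarrow> \<beta> x m \<in> carrier G"
      and addl: "\<And>x y m. \<lbrakk>x \<in> carrier A; y \<in> carrier A; m \<in> carrier ?R\<rbrakk> \<Longrightarrow>
        \<beta> (x \<oplus> y) m = \<beta> x m \<oplus>\<^bsub>G\<^esub> \<beta> y m"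
      and balance: "\<And>x b m. \<lbrakk>x \<in> carrier A; b \<in> B; m \<in> carrier ?R\<rbrakk> \<Longrightarrow>
        \<beta> (x \<otimes> b) m = \<beta> x (lsmult ?R b m)"
    interpret G: abelian_group G by (rule G)
    have "balanced_map A B 1 (add_monoid G) (\<lambda>xs. \<beta> (hd xs) \<one>)"
      by (rule balanced_mapI) (auto dest!: tup1 simp: tuples_append R B closed addl)
    from tensor_group_universal[OF G.a_comm_group this]
    obtain h where h: "h \<in> hom (tensor_group A B 1) (add_monoid G)"
      and hp: "\<And>xs. xs \<in> tuples A 1 \<Longrightarrow> h (pure_tensor A B 1 xs) = \<beta> (hd xs) \<one>"
      by blast
    have h\<tau>: "h (?p (x \<otimes> b)) = \<beta> x b" if "x \<in> carrier A" "b \<in> B" for x b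
      using that balance[of x b \<one>] hp[of "[x \<otimes> b]"] by (simp add: R B)
    show "\<exists>h \<in> hom (add_monoid (tensor_power A B 1)) (add_monoid G).
        \<forall>x \<in> carrier A. \<forall>m \<in> carrier ?R. h (?p (x \<otimes> m)) = \<beta> x m"
    proof (rule bexI[where x = h])
      show "h \<in> hom (add_monoid (tensor_power A B 1)) (add_monoid G)"
        using h unfolding hom_tensor_power .
    qed (use h\<tau> in \<open>simp add: R\<close>)
  }
  {
    fix G :: "('a, 'a, ('a list \<Rightarrow>\<^sub>0 int) set) bimodule" and h k
    assume G: "abelian_group G"
      and h: "h \<in> hom (add_monoid (tensor_power A B 1)) (add_monoid G)"
      and k: "k \<in> hom (add_monoid (tensor_power A B 1)) (add_monoid G)"
      and hk: "\<And>x m. \<lbrakk>x \<in> carrier A; m \<in> carrier ?R\<rbrakk> \<Longrightarrow> h (?p (x \<otimes> m)) = k (?p (x \<otimes> m))"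
    show "\<forall>e \<in> carrier (tensor_power A B 1). h e = k e"
    proof
      fix e assume "e \<in> carrier (tensor_power A B 1)"
      then have e: "e \<in> carrier (tensor_group A B 1)" by simp
      show "h e = k e"
      proof (rule tensor_group_hom_eq[OF abelian_group.a_group[OF G] h[unfolded hom_tensor_power] k[unfolded hom_tensor_power] _ e])
        fix xs assume "xs \<in> tuples A 1"
        then obtain x where "xs = [x]" "x \<in> carrier A" using tup1[of xs] by auto
        then show "h (pure_tensor A B 1 xs) = k (pure_tensor A B 1 xs)"
          using hk[of x \<one>] by (simp add: R B)
      qed
    qed
  }
qed

end

section \<open>The opposite ring\<close>

text \<open>Right depth is left depth of the opposite extension, because reversing tuples exchanges the left
  and the right multiplication of \<open>C\<^sub>n(A, B)\<close>. In this way everything that was shown for \<open>A \<otimes>\<^sub>B -\<close> also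
  serves for \<open>- \<otimes>\<^sub>B A\<close>.\<close>

definition opposite :: "('a, 'r) ring_scheme \<Rightarrow> ('a, 'r) ring_scheme" where
  "opposite A = A\<lparr>monoid.mult := \<lambda>x y. y \<otimes>\<^bsub>A\<^esub> x\<rparr>"

lemma opposite_sel [simp]:
  "carrier (opposite A) = carrier A" "x \<otimes>\<^bsub>opposite A\<^esub> y = y \<otimes>\<^bsub>A\<^esub> x" "\<one>\<^bsub>opposite A\<^esub> = \<one>\<^bsub>A\<^esub>"
  "\<zero>\<^bsub>opposite A\<^esub> = \<zero>\<^bsub>A\<^esub>" "x \<oplus>\<^bsub>opposite A\<^esub> y = x \<oplus>\<^bsub>A\<^esub> y" "opposite (opposite A) = A"
  "(opposite A)\<lparr>carrier := carrier A\<rparr> = opposite A"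
  by (simp_all add: opposite_def)

lemma opposite_ring:
  assumes "ring A"
  shows "ring (opposite A)"
proof -
  interpret ring A by (rule assms)
  have "abelian_group (opposite A)"
  proof (rule abelian_groupI)
    fix x assume "x \<in> carrier (opposite A)"
    then show "\<exists>y\<in>carrier (opposite A). y \<oplus>\<^bsub>opposite A\<^esub> x = \<zero>\<^bsub>opposite A\<^esub>"
      using l_neg[of x] a_inv_closed[of x] by auto
  qed (simp_all add: a_ac)
  moreover have "Group.monoid (opposite A)"
    by unfold_locales (auto simp: m_assoc)
  ultimately show ?thesis
    by (rule ringI) (auto simp: l_distr r_distr)
qed

lemma opposite_subring:
  assumes "ring A" "subring P A"
  shows "subring P (opposite A)"
proof -
  interpret O: ring "opposite A" by (rule opposite_ring[OF assms(1)])
  have inv: "\<ominus>\<^bsub>opposite A\<^esub> x = \<ominus>\<^bsub>A\<^esub> x" for x by (simp add: a_inv_def m_inv_def)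
  show ?thesis
    using subringE[OF assms(2)] by (intro O.subringI) (auto simp: inv)
qed

definition bimodule_anti_hom ::
  "('a, 'r) ring_scheme \<Rightarrow> ('b, 's) ring_scheme \<Rightarrow>
   ('a, 'b, 'm, 'y) bimodule_scheme \<Rightarrow> ('b, 'a, 'n, 'z) bimodule_scheme \<Rightarrow> ('m \<Rightarrow> 'n) set" where
  "bimodule_anti_hom R S M N = {h \<in> hom (add_monoid M) (add_monoid N).
      (\<forall>r \<in> carrier R. \<forall>x \<in> carrier M. h (lsmult M r x) = rsmult N (h x) r) \<and>
      (\<forall>x \<in> carrier M. \<forall>s \<in> carrier S. h (rsmult M x s) = lsmult N s (h x))}"

lemma bimodule_anti_homD:
  assumes "h \<in> bimodule_anti_hom R S M N"
  shows "h \<in> hom (add_monoid M) (add_monoid N)"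
    and "x \<in> carrier M \<Longrightarrow> h x \<in> carrier N"
    and "\<lbrakk>x \<in> carrier M; y \<in> carrier M\<rbrakk> \<Longrightarrow> h (x \<oplus>\<^bsub>M\<^esub> y) = h x \<oplus>\<^bsub>N\<^esub> h y"
    and "\<lbrakk>r \<in> carrier R; x \<in> carrier M\<rbrakk> \<Longrightarrow> h (lsmult M r x) = rsmult N (h x) r"
    and "\<lbrakk>x \<in> carrier M; s \<in> carrier S\<rbrakk> \<Longrightarrow> h (rsmult M x s) = lsmult N s (h x)"
  using assms by (auto simp: bimodule_anti_hom_def hom_def)

lemma bimodule_anti_hom_conjugate:
  assumes f: "f \<in> bimodule_hom R S M N"
    and \<alpha>: "\<alpha> \<in> bimodule_anti_hom S R M' M" and \<beta>: "\<beta> \<in> bimodule_anti_hom R S N N'"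
  shows "(\<lambda>x. \<beta> (f (\<alpha> x))) \<in> bimodule_hom S R M' N'"
  by (rule bimodule_homI)
    (simp_all add: bimodule_homD[OF f] bimodule_anti_homD[OF \<alpha>] bimodule_anti_homD[OF \<beta>])

text \<open>The rings \<open>R'\<close> and \<open>S'\<close> are related to \<open>R\<close> and \<open>S\<close> by their carriers only: their multiplications,
  opposite to the given ones in the application, enter through the hypotheses on \<open>M'\<close> and \<open>N'\<close>.\<close>

lemma summand_of_power_anti_iso:
  assumes M: "bimodule R S M" and N: "bimodule R S N" and M': "bimodule S' R' M'" and N': "bimodule S' R' N'"
    and car: "carrier S' = carrier S" "carrier R' = carrier R"
    and \<alpha>: "\<alpha> \<in> bimodule_anti_hom R S M M'" and \<alpha>': "\<alpha>' \<in> bimodule_anti_hom S R M' M"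
    and \<beta>: "\<beta> \<in> bimodule_anti_hom R S N N'" and \<beta>': "\<beta>' \<in> bimodule_anti_hom S R N' N"
    and \<alpha>\<alpha>: "\<And>x. x \<in> carrier M \<Longrightarrow> \<alpha>' (\<alpha> x) = x" and \<beta>\<beta>: "\<And>y. y \<in> carrier N' \<Longrightarrow> \<beta> (\<beta>' y) = y"
    and summand: "summand_of_power R S N M q"
  shows "summand_of_power S' R' N' M' q"
proof -
  interpret N: bimodule R S N by (rule N)
  interpret N': bimodule S' R' N' by (rule N')
  obtain f g where fg: "\<forall>i<q. f i \<in> bimodule_hom R S M N \<and> g i \<in> bimodule_hom R S N M"
    and id: "\<forall>x \<in> carrier N. (\<Oplus>\<^bsub>N\<^esub>i\<in>{..<q}. f i (g i x)) = x"
    using summand unfolding summand_of_power_iff[OF M N] by (elim exE conjE)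
  have f: "f i \<in> bimodule_hom R S M N" and g: "g i \<in> bimodule_hom R S N M" if "i < q" for i
    using fg that by auto
  let ?f = "\<lambda>i y. \<beta> (f i (\<alpha>' y))" and ?g = "\<lambda>i y. \<alpha> (g i (\<beta>' y))"
  have "?f i \<in> bimodule_hom S' R' M' N'" "?g i \<in> bimodule_hom S' R' N' M'" if "i < q" for i
    using bimodule_anti_hom_conjugate[OF f[OF that] \<alpha>' \<beta>] bimodule_anti_hom_conjugate[OF g[OF that] \<beta>' \<alpha>]
    by (simp_all add: bimodule_hom_def car)
  moreover have "(\<Oplus>\<^bsub>N'\<^esub>i\<in>{..<q}. ?f i (?g i y)) = y" if y: "y \<in> carrier N'" for y
  proof -
    note y' = bimodule_anti_homD(2)[OF \<beta>' y]
    have gM: "g i (\<beta>' y) \<in> carrier M" if "i < q" for i using bimodule_homD(2)[OF g[OF that] y'] .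
    have fN: "f i (g i (\<beta>' y)) \<in> carrier N" if "i < q" for i using bimodule_homD(2)[OF f[OF that] gM[OF that]] .
    have "(\<Oplus>\<^bsub>N'\<^esub>i\<in>{..<q}. ?f i (?g i y)) = (\<Oplus>\<^bsub>N'\<^esub>i\<in>{..<q}. \<beta> (f i (g i (\<beta>' y))))"
      by (rule N'.finsum_cong') (auto simp: \<alpha>\<alpha> gM fN bimodule_anti_homD(2)[OF \<beta>])
    also have "\<dots> = \<beta> (\<Oplus>\<^bsub>N\<^esub>i\<in>{..<q}. f i (g i (\<beta>' y)))"
      by (rule add_hom_finsum[symmetric, OF N.abelian_group_axioms N'.abelian_group_axioms bimodule_anti_homD(1)[OF \<beta>]])
        (auto simp: fN)
    also have "\<dots> = y" using id y' \<beta>\<beta>[OF y] by simp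
    finally show ?thesis .
  qed
  ultimately show ?thesis
    unfolding summand_of_power_iff[OF M' N'] by (intro exI[where x = ?f] exI[where x = ?g]) simp
qed

context ring_extension
begin

lemma opposite_ring_extension: "ring_extension (opposite A) B"
  using opposite_ring[OF A.ring_axioms] opposite_subring[OF A.ring_axioms subring_B]
  by (simp add: ring_extension_def ring_extension_axioms_def)

lemma tuples_opposite [simp]: "tuples (opposite A) n = tuples A n"
  by (simp add: tuples_def)

lemma tuples_rev [simp]: "rev xs \<in> tuples A n \<longleftrightarrow> xs \<in> tuples A n"
  by (simp add: tuples_def)

lemma tensor_reversal:
  "\<exists>\<rho> \<in> bimodule_anti_hom A A (tensor_power A B (Suc n)) (tensor_power (opposite A) B (Suc n)).
    \<forall>xs \<in> tuples A (Suc n). \<rho> (pure_tensor A B (Suc n) xs) = pure_tensor (opposite A) B (Suc n) (rev xs)"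
proof -
  let ?T = "tensor_group A B (Suc n)" and ?T' = "tensor_group (opposite A) B (Suc n)"
  let ?C = "tensor_power A B (Suc n)" and ?C' = "tensor_power (opposite A) B (Suc n)"
  let ?p = "pure_tensor A B (Suc n)" and ?p' = "pure_tensor (opposite A) B (Suc n)"
  interpret O: ring_extension "opposite A" B by (rule opposite_ring_extension)
  interpret T': comm_group ?T' by (rule O.tensor_group_comm_group)
  have "balanced_map A B (Suc n) ?T' (\<lambda>xs. ?p' (rev xs))"
  proof (rule balanced_mapI)
    fix xs assume "xs \<in> tuples A (Suc n)"
    then show "?p' (rev xs) \<in> carrier ?T'" by (intro O.pure_tensor_closed) simp
  next
    fix xs x y ys assume t: "xs @ x # ys \<in> tuples A (Suc n)" and y: "y \<in> carrier A"
    then show "?p' (rev (xs @ (x \<oplus> y) # ys)) = ?p' (rev (xs @ x # ys)) \<otimes>\<^bsub>?T'\<^esub> ?p' (rev (xs @ y # ys))"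
      using O.pure_tensor_add[of "rev ys" x "rev xs" "Suc n" y] by (simp add: tuples_append)
  next
    fix xs x b y ys assume t: "xs @ x # y # ys \<in> tuples A (Suc n)" and b: "b \<in> B"
    then show "?p' (rev (xs @ (x \<otimes> b) # y # ys)) = ?p' (rev (xs @ x # (b \<otimes> y) # ys))"
      using O.pure_tensor_balance[of "rev ys" y x "rev xs" "Suc n" b] by (simp add: tuples_append)
  qed
  from tensor_group_universal[OF T'.comm_group_axioms this]
  obtain \<rho> where \<rho>: "\<rho> \<in> hom ?T ?T'" and \<rho>p: "\<And>xs. xs \<in> tuples A (Suc n) \<Longrightarrow> \<rho> (?p xs) = ?p' (rev xs)" by blast
  note comp = hom_compose[unfolded comp_def]
  note eq = tensor_group_hom_eq[OF T'.is_group]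
  have snoc: "ys @ [y] \<in> tuples A (Suc n)" if "ys \<in> tuples A n" "y \<in> carrier A" for y ys
    using that by (auto simp: tuples_def)
  have "\<rho> \<in> bimodule_anti_hom A A ?C ?C'"
    unfolding bimodule_anti_hom_def
  proof (intro CollectI conjI ballI)
    show "\<rho> \<in> hom (add_monoid ?C) (add_monoid ?C')" unfolding hom_tensor_power by (rule \<rho>)
  next
    fix r X assume r: "r \<in> carrier A" and "X \<in> carrier ?C"
    then have X: "X \<in> carrier ?T" by simp
    show "\<rho> (lsmult ?C r X) = rsmult ?C' (\<rho> X) r"
    proof (rule eq[OF comp[OF lsmult_hom \<rho>] comp[OF \<rho> O.rsmult_hom] _ X])
      fix xs assume "xs \<in> tuples A (Suc n)"
      then obtain x ys where "xs = x # ys" "x \<in> carrier A" "ys \<in> tuples A n" by (rule tuples_Suc_cases)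
      then show "\<rho> (lsmult ?C r (?p xs)) = rsmult ?C' (\<rho> (?p xs)) r"
        using r O.rsmult_pure_tensor[of r x "rev ys" n] by (simp add: lsmult_pure_tensor \<rho>p)
    qed (use r in auto)
  next
    fix X r assume "X \<in> carrier ?C" and r: "r \<in> carrier A"
    then have X: "X \<in> carrier ?T" by simp
    show "\<rho> (rsmult ?C X r) = lsmult ?C' r (\<rho> X)"
    proof (rule eq[OF comp[OF rsmult_hom \<rho>] comp[OF \<rho> O.lsmult_hom] _ X])
      fix xs assume "xs \<in> tuples A (Suc n)"
      then obtain x ys where "xs = ys @ [x]" "x \<in> carrier A" "ys \<in> tuples A n" by (rule tuples_Suc_rev_cases)
      then show "\<rho> (rsmult ?C (?p xs) r) = lsmult ?C' r (\<rho> (?p xs))"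
        using r O.lsmult_pure_tensor[of r x "rev ys" n] snoc by (simp add: rsmult_pure_tensor \<rho>p)
    qed (use r in auto)
  qed
  then show ?thesis using \<rho>p by blast
qed

lemma tensor_reversal_iso:
  obtains \<rho> \<rho>' where
    "\<rho> \<in> bimodule_anti_hom A A (tensor_power A B (Suc n)) (tensor_power (opposite A) B (Suc n))"
    "\<rho>' \<in> bimodule_anti_hom A A (tensor_power (opposite A) B (Suc n)) (tensor_power A B (Suc n))"
    "\<forall>X \<in> carrier (tensor_power A B (Suc n)). \<rho>' (\<rho> X) = X"
    "\<forall>X \<in> carrier (tensor_power (opposite A) B (Suc n)). \<rho> (\<rho>' X) = X"
proof -
  let ?T = "tensor_group A B (Suc n)" and ?T' = "tensor_group (opposite A) B (Suc n)"
  let ?C = "tensor_power A B (Suc n)" and ?C' = "tensor_power (opposite A) B (Suc n)"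
  let ?p = "pure_tensor A B (Suc n)" and ?p' = "pure_tensor (opposite A) B (Suc n)"
  interpret O: ring_extension "opposite A" B by (rule opposite_ring_extension)
  obtain \<rho> where \<rho>: "\<rho> \<in> bimodule_anti_hom A A ?C ?C'"
    and \<rho>p: "\<forall>xs \<in> tuples A (Suc n). \<rho> (?p xs) = ?p' (rev xs)"
    using tensor_reversal[of n] by (elim bexE)
  have "\<exists>\<rho>' \<in> bimodule_anti_hom (opposite A) (opposite A) ?C' ?C.
    \<forall>xs \<in> tuples A (Suc n). \<rho>' (?p' xs) = ?p (rev xs)"
    using O.tensor_reversal[of n] unfolding opposite_sel tuples_opposite .
  then obtain \<rho>' where \<rho>': "\<rho>' \<in> bimodule_anti_hom (opposite A) (opposite A) ?C' ?C"
    and \<rho>'p: "\<forall>xs \<in> tuples A (Suc n). \<rho>' (?p' xs) = ?p (rev xs)"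
    by (elim bexE)
  note h = bimodule_anti_homD(1)[OF \<rho>, unfolded hom_tensor_power]
    and h' = bimodule_anti_homD(1)[OF \<rho>', unfolded hom_tensor_power]
  note comp = hom_compose[unfolded comp_def]
  have id: "(\<lambda>X. X) \<in> hom G G" for G :: "('g, 'h) monoid_scheme" by (simp add: hom_def)
  show ?thesis
  proof
    show "\<rho> \<in> bimodule_anti_hom A A ?C ?C'" by (rule \<rho>)
    show "\<rho>' \<in> bimodule_anti_hom A A ?C' ?C" using \<rho>' by (simp add: bimodule_anti_hom_def)
    show "\<forall>X \<in> carrier ?C. \<rho>' (\<rho> X) = X"
    proof
      fix X assume "X \<in> carrier ?C"
      then have X: "X \<in> carrier ?T" by simp
      show "\<rho>' (\<rho> X) = X"
        by (rule tensor_group_hom_eq[OF tensor_group_is_group comp[OF h h'] id _ X]) (simp add: \<rho>p \<rho>'p)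
    qed
    show "\<forall>X \<in> carrier ?C'. \<rho> (\<rho>' X) = X"
    proof
      fix X assume "X \<in> carrier ?C'"
      then have X: "X \<in> carrier ?T'" by simp
      show "\<rho> (\<rho>' X) = X"
        by (rule O.tensor_group_hom_eq[OF O.tensor_group_is_group comp[OF h' h] id _ X]) (simp add: \<rho>p \<rho>'p)
    qed
  qed
qed

lemma summand_opposite:
  assumes P: "subring P A" and Q: "subring Q A"
    and "summand_of_power (A\<lparr>carrier := P\<rparr>) (A\<lparr>carrier := Q\<rparr>) (tensor_power A B (Suc m)) (tensor_power A B (Suc n)) q"
  shows "summand_of_power ((opposite A)\<lparr>carrier := Q\<rparr>) ((opposite A)\<lparr>carrier := P\<rparr>)
    (tensor_power (opposite A) B (Suc m)) (tensor_power (opposite A) B (Suc n)) q"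
proof -
  interpret O: ring_extension "opposite A" B by (rule opposite_ring_extension)
  obtain \<alpha> \<alpha>' where \<alpha>: "\<alpha> \<in> bimodule_anti_hom A A (tensor_power A B (Suc n)) (tensor_power (opposite A) B (Suc n))"
    "\<alpha>' \<in> bimodule_anti_hom A A (tensor_power (opposite A) B (Suc n)) (tensor_power A B (Suc n))"
    "\<forall>X \<in> carrier (tensor_power A B (Suc n)). \<alpha>' (\<alpha> X) = X"
    "\<forall>X \<in> carrier (tensor_power (opposite A) B (Suc n)). \<alpha> (\<alpha>' X) = X"
    by (rule tensor_reversal_iso[of n])
  obtain \<beta> \<beta>' where \<beta>: "\<beta> \<in> bimodule_anti_hom A A (tensor_power A B (Suc m)) (tensor_power (opposite A) B (Suc m))"
    "\<beta>' \<in> bimodule_anti_hom A A (tensor_power (opposite A) B (Suc m)) (tensor_power A B (Suc m))"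
    "\<forall>X \<in> carrier (tensor_power A B (Suc m)). \<beta>' (\<beta> X) = X"
    "\<forall>X \<in> carrier (tensor_power (opposite A) B (Suc m)). \<beta> (\<beta>' X) = X"
    by (rule tensor_reversal_iso[of m])
  have restrict: "h \<in> bimodule_anti_hom (A\<lparr>carrier := P'\<rparr>) (A\<lparr>carrier := Q'\<rparr>) X Y"
    if "h \<in> bimodule_anti_hom A A X Y" "subring P' A" "subring Q' A"
    for h P' Q' and X Y :: "('a, 'a, ('a list \<Rightarrow>\<^sub>0 int) set) bimodule"
    using that(1) subringE(1)[OF that(2)] subringE(1)[OF that(3)] by (auto simp: bimodule_anti_hom_def)
  note opp = opposite_subring[OF A.ring_axioms]
  show ?thesis
  proof (rule summand_of_power_anti_iso[OF _ _ _ _ _ _ restrict[OF \<alpha>(1) P Q] restrict[OF \<alpha>(2) Q P]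
        restrict[OF \<beta>(1) P Q] restrict[OF \<beta>(2) Q P] bspec[OF \<alpha>(3)] bspec[OF \<beta>(4)] assms(3)])
  qed (simp_all add: P Q tensor_power_bimodule_restrict O.tensor_power_bimodule_restrict opp)
qed

lemma summand_induce_left:
  assumes "subring Q A"
    and "summand_of_power (A\<lparr>carrier := B\<rparr>) (A\<lparr>carrier := Q\<rparr>) (tensor_power A B (Suc m)) (tensor_power A B (Suc n)) q"
  shows "summand_of_power A (A\<lparr>carrier := Q\<rparr>) (tensor_power A B (Suc (Suc m))) (tensor_power A B (Suc (Suc n))) q"
  using tensor_power_induced[OF assms(1), of m] tensor_power_induced[OF assms(1), of n]
    induced_summand_of_power[OF _ _ assms(2)] by blast

text \<open>This is \<open>- \<otimes>\<^sub>B A\<close>, obtained by passing to the opposite ring, inducing on the left there and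
  passing back.\<close>

lemma summand_induce_right:
  assumes P: "subring P A"
    and "summand_of_power (A\<lparr>carrier := P\<rparr>) (A\<lparr>carrier := B\<rparr>) (tensor_power A B (Suc m)) (tensor_power A B (Suc n)) q"
  shows "summand_of_power (A\<lparr>carrier := P\<rparr>) A (tensor_power A B (Suc (Suc m))) (tensor_power A B (Suc (Suc n))) q"
proof -
  interpret O: ring_extension "opposite A" B by (rule opposite_ring_extension)
  have "summand_of_power (opposite A) ((opposite A)\<lparr>carrier := P\<rparr>)
      (tensor_power (opposite A) B (Suc (Suc m))) (tensor_power (opposite A) B (Suc (Suc n))) q"
    by (intro O.summand_induce_left summand_opposite opposite_subring assms subring_B A.ring_axioms)
  then have "summand_of_power ((opposite A)\<lparr>carrier := carrier (opposite A)\<rparr>) ((opposite A)\<lparr>carrier := P\<rparr>)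
      (tensor_power (opposite A) B (Suc (Suc m))) (tensor_power (opposite A) B (Suc (Suc n))) q" by simp
  from O.summand_opposite[OF O.A.carrier_is_subring opposite_subring[OF A.ring_axioms P] this]
  show ?thesis by simp
qed

lemma tensor_power_summand_Suc_left:
  "summand_of_power (A\<lparr>carrier := B\<rparr>) A (tensor_power A B (Suc n)) (tensor_power A B (Suc (Suc n))) 1"
  using tensor_power_induced[OF A.carrier_is_subring, of n]
    induced_counit_splits[OF _ tensor_power_bimodule subring_B] by auto

lemma tensor_power_summand_Suc_right:
  "summand_of_power A (A\<lparr>carrier := B\<rparr>) (tensor_power A B (Suc n)) (tensor_power A B (Suc (Suc n))) 1"
proof -
  interpret O: ring_extension "opposite A" B by (rule opposite_ring_extension)
  have "summand_of_power ((opposite A)\<lparr>carrier := B\<rparr>) ((opposite A)\<lparr>carrier := carrier (opposite A)\<rparr>)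
      (tensor_power (opposite A) B (Suc n)) (tensor_power (opposite A) B (Suc (Suc n))) 1"
    using O.tensor_power_summand_Suc_left[of n] by simp
  from O.summand_opposite[OF O.subring_B O.A.carrier_is_subring this]
  show ?thesis by simp
qed

section \<open>Comparing depth and H-depth\<close>

lemma summand_induce_both:
  assumes "summand_of_power (A\<lparr>carrier := B\<rparr>) (A\<lparr>carrier := B\<rparr>) (tensor_power A B (Suc m)) (tensor_power A B (Suc n)) q"
  shows "summand_of_power A A (tensor_power A B (Suc (Suc (Suc m)))) (tensor_power A B (Suc (Suc (Suc n)))) q"
  using summand_induce_right[OF A.carrier_is_subring] summand_induce_left[OF subring_B assms] by simp

lemma has_H_depth_imp_left_right_depth:
  assumes H: "has_H_depth A B (2 * n - 1)" and n: "n \<ge> 1"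
  shows "has_left_depth A B (2 * n)" and "has_right_depth A B (2 * n)"
proof -
  obtain k where k: "n = Suc k" using n by (cases n) auto
  obtain n' q where n': "n' \<ge> 1" "2 * n - 1 = 2 * n' - 1" and q: "q \<ge> 1"
    and "summand_of_power A A (tensor_power A B (n' + 1)) (tensor_power A B n') q"
    using H unfolding has_H_depth_def by blast
  moreover have "n' = n" using n' n by linarith
  ultimately have AA: "summand_of_power A A (tensor_power A B (Suc (Suc k))) (tensor_power A B (Suc k)) q"
    by (simp add: k)
  have bimod: "bimodule (A\<lparr>carrier := B\<rparr>) A (tensor_power A B (Suc j))"
    "bimodule A (A\<lparr>carrier := B\<rparr>) (tensor_power A B (Suc j))" for j
    using tensor_power_bimodule_restrict[OF subring_B A.carrier_is_subring, of j]
      tensor_power_bimodule_restrict[OF A.carrier_is_subring subring_B, of j] by simp_all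
  note restrict = summand_of_power_restrict[OF tensor_power_bimodule tensor_power_bimodule AA]
  have "summand_of_power (A\<lparr>carrier := B\<rparr>) A (tensor_power A B (Suc (Suc k))) (tensor_power A B (Suc k)) q"
    by (rule restrict) (auto simp: bimod B_carrier)
  moreover have "summand_of_power A (A\<lparr>carrier := B\<rparr>) (tensor_power A B (Suc (Suc k))) (tensor_power A B (Suc k)) q"
    by (rule restrict) (auto simp: bimod B_carrier)
  ultimately have "H_equivalent (A\<lparr>carrier := B\<rparr>) A (tensor_power A B (Suc (Suc k))) (tensor_power A B (Suc k))"
    "H_equivalent A (A\<lparr>carrier := B\<rparr>) (tensor_power A B (Suc (Suc k))) (tensor_power A B (Suc k))"
    using tensor_power_summand_Suc_left[of k] tensor_power_summand_Suc_right[of k] q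
    unfolding H_equivalent_def by blast+
  then show "has_left_depth A B (2 * n)" "has_right_depth A B (2 * n)"
    using k unfolding has_left_depth_def has_right_depth_def by auto
qed

lemma left_depth_imp_has_H_depth:
  assumes "has_left_depth A B (2 * n)"
  shows "has_H_depth A B (2 * n + 1)"
proof -
  obtain q where n: "n \<ge> 1" and q: "q \<ge> 1"
    and s: "summand_of_power (A\<lparr>carrier := B\<rparr>) A (tensor_power A B (n + 1)) (tensor_power A B n) q"
    using assms unfolding has_left_depth_def H_equivalent_def by auto
  obtain k where k: "n = Suc k" using n by (cases n) auto
  have "summand_of_power A A (tensor_power A B (Suc (Suc (Suc k)))) (tensor_power A B (Suc (Suc k))) q"
    using summand_induce_left[OF A.carrier_is_subring, of "Suc k" k q] s by (simp add: k)
  then show ?thesis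
    unfolding has_H_depth_def using q by (intro exI[of _ "Suc n"]) (auto simp: k)
qed

lemma right_depth_imp_has_H_depth:
  assumes "has_right_depth A B (2 * n)"
  shows "has_H_depth A B (2 * n + 1)"
proof -
  obtain q where n: "n \<ge> 1" and q: "q \<ge> 1"
    and s: "summand_of_power A (A\<lparr>carrier := B\<rparr>) (tensor_power A B (n + 1)) (tensor_power A B n) q"
    using assms unfolding has_right_depth_def H_equivalent_def by auto
  obtain k where k: "n = Suc k" using n by (cases n) auto
  have "summand_of_power A A (tensor_power A B (Suc (Suc (Suc k)))) (tensor_power A B (Suc (Suc k))) q"
    using summand_induce_right[OF A.carrier_is_subring, of "Suc k" k q] s by (simp add: k)
  then show ?thesis
    unfolding has_H_depth_def using q by (intro exI[of _ "Suc n"]) (auto simp: k)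
qed

text \<open>Over \<open>B\<close> on both sides one has to induce on both sides, which costs two tensor factors and so
  accounts for the bound \<open>2\<close>. For depth \<open>1\<close> the first induction starts from \<open>C\<^sub>0(A, B) = B\<close>.\<close>

lemma odd_depth_imp_has_H_depth:
  assumes "has_odd_depth A B m"
  shows "has_H_depth A B (m + 2)"
proof -
  let ?B = "A\<lparr>carrier := B\<rparr>" and ?C = "tensor_power A B"
  obtain n where m: "m = 2 * n + 1"
    and n: "if n = 0 then H_equivalent ?B ?B (?C 1) (regular_bimodule ?B) else H_equivalent ?B ?B (?C (n + 1)) (?C n)"
    using assms unfolding has_odd_depth_def by blast
  have "\<exists>q \<ge> 1. summand_of_power A A (?C (Suc (Suc (Suc n)))) (?C (Suc (Suc n))) q"
  proof (cases n)
    case 0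
    then obtain q where q: "q \<ge> 1" "summand_of_power ?B ?B (?C 1) (regular_bimodule ?B) q"
      using n unfolding H_equivalent_def by auto
    obtain \<tau> where "induced_bimodule A B ?B (?C (Suc 0)) (?C (Suc (Suc 0))) \<tau>"
      using tensor_power_induced[OF subring_B] by blast
    from induced_summand_of_power[OF regular_bimodule_induced this] q(2)
    have "summand_of_power A ?B (?C (Suc (Suc 0))) (?C (Suc 0)) q" by simp
    then have "summand_of_power A A (?C (Suc (Suc (Suc 0)))) (?C (Suc (Suc 0))) q"
      using summand_induce_right[OF A.carrier_is_subring] by simp
    then show ?thesis using 0 q(1) by blast
  next
    case (Suc k)
    then obtain q where q: "q \<ge> 1" "summand_of_power ?B ?B (?C (Suc (Suc k))) (?C (Suc k)) q"
      using n unfolding H_equivalent_def by auto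
    from summand_induce_both[OF q(2)] show ?thesis using Suc q(1) by blast
  qed
  \<comment> \<open>\<open>m + 2 = 2 (n + 2) - 1\<close>.\<close>
  then show ?thesis
    unfolding has_H_depth_def by (intro exI[of _ "Suc (Suc n)"]) (simp add: m)
qed

lemma has_H_depth_imp_has_depth:
  assumes "has_H_depth A B m"
  shows "has_depth A B (m + 1)"
proof -
  obtain n where "n \<ge> 1" "m = 2 * n - 1" using assms unfolding has_H_depth_def by blast
  then show ?thesis
    using has_H_depth_imp_left_right_depth[of n] assms by (simp add: has_depth_def)
qed

lemma has_depth_imp_has_H_depth:
  assumes "has_depth A B m"
  obtains k where "k \<le> m + 2" "has_H_depth A B k"
  using assms unfolding has_depth_def
proof (elim disjE conjE)
  assume left: "has_left_depth A B m"
  then obtain n where "m = 2 * n" unfolding has_left_depth_def by blast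
  then show thesis using left_depth_imp_has_H_depth[of n] left that[of "m + 1"] by simp
next
  assume "has_odd_depth A B m"
  then show thesis using odd_depth_imp_has_H_depth that[of "m + 2"] by simp
qed

end

lemma Inf_enat_attained:
  fixes P :: "nat \<Rightarrow> bool"
  assumes "P k"
  obtains m where "Inf {enat m |m. P m} = enat m" "P m" "m \<le> k"
proof -
  have "Inf {enat m |m. P m} \<in> {enat m |m. P m}"
    using assms by (intro wellorder_InfI) auto
  then obtain m where m: "Inf {enat m |m. P m} = enat m" "P m" by blast
  moreover have "Inf {enat m |m. P m} \<le> enat k" by (rule Inf_lower) (use assms in blast)
  ultimately show ?thesis using that by simp
qed

lemma Inf_enat_finite:
  assumes "Inf {enat m |m. P m} \<noteq> \<infinity>"
  obtains k where "P k"
proof -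
  have "{enat m |m. P m} \<noteq> {}"
  proof
    assume "{enat m |m. P m} = {}"
    with assms show False by (simp only: Inf_empty top_enat_def)
  qed
  then show ?thesis using that by blast
qed

theorem proposition2p4:
  fixes A :: "('a, 'r) ring_scheme" and B :: "'a set"
  assumes "ring A" and "subring B A"
  shows "(\<forall>n \<ge> 1. has_H_depth A B (2 * n - 1) \<longrightarrow> has_depth A B (2 * n)) \<and>
    (\<forall>n \<ge> 1. has_left_depth A B (2 * n) \<or> has_right_depth A B (2 * n) \<longrightarrow>
      has_H_depth A B (2 * n + 1)) \<and>
    (min_depth A B \<noteq> \<infinity> \<or> min_H_depth A B \<noteq> \<infinity> \<longrightarrow>
      min_depth A B \<noteq> \<infinity> \<and> min_H_depth A B \<noteq> \<infinity> \<and>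
      \<bar>int (the_enat (min_depth A B)) - int (the_enat (min_H_depth A B))\<bar> \<le> 2)"
proof (intro conjI allI impI)
  interpret ring_extension A B using assms by (simp add: ring_extension_def ring_extension_axioms_def)
  show "has_depth A B (2 * n)" if "n \<ge> 1" "has_H_depth A B (2 * n - 1)" for n
    using has_H_depth_imp_left_right_depth[OF that(2,1)] by (simp add: has_depth_def)
  show "has_H_depth A B (2 * n + 1)" if "has_left_depth A B (2 * n) \<or> has_right_depth A B (2 * n)" for n
    using that left_depth_imp_has_H_depth right_depth_imp_has_H_depth by blast
  assume finite: "min_depth A B \<noteq> \<infinity> \<or> min_H_depth A B \<noteq> \<infinity>"
  have "\<exists>h. has_H_depth A B h"
    using finite
  proof
    assume "min_depth A B \<noteq> \<infinity>"
    then show ?thesis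
      unfolding min_depth_def by (elim Inf_enat_finite) (metis has_depth_imp_has_H_depth)
  next
    assume "min_H_depth A B \<noteq> \<infinity>"
    then show ?thesis
      unfolding min_H_depth_def by (elim Inf_enat_finite) blast
  qed
  then obtain h where h: "min_H_depth A B = enat h" "has_H_depth A B h"
    unfolding min_H_depth_def by (metis Inf_enat_attained)
  obtain d where d: "min_depth A B = enat d" "has_depth A B d" "d \<le> h + 1"
    using Inf_enat_attained[of "\<lambda>m. 0 < m \<and> has_depth A B m" "h + 1"] has_H_depth_imp_has_depth[OF h(2)]
    unfolding min_depth_def by auto
  obtain k where k: "k \<le> d + 2" "has_H_depth A B k"
    using d(2) by (rule has_depth_imp_has_H_depth)
  have "h \<le> k"
    using Inf_enat_attained[of "has_H_depth A B" k] k(2) h(1) unfolding min_H_depth_def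
    by (metis enat.inject)
  then show "min_depth A B \<noteq> \<infinity>" "min_H_depth A B \<noteq> \<infinity>"
    "\<bar>int (the_enat (min_depth A B)) - int (the_enat (min_H_depth A B))\<bar> \<le> 2"
    using h d k by auto
qed

end
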